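(* Let $G$ be a finite group of order $n$ such that the number of distinct primes dividing $n$ is at most $99$. Then $S_c(G)\leq S_c(C_n)$, where $C_n$ is the cyclic group of order $n$.
   Context: All groups are finite. $\mathrm{Irr}(G)$ denotes the set of complex irreducible characters of a finite group $G$. For $\chi\in\mathrm{Irr}(G)$, the codegree of $\chi$ is $\mathrm{cod}(\chi)=\frac{|G:\ker\chi|}{\chi(1)}$. The sum of codegrees is $S_c(G)=\sum_{\chi\in\mathrm{Irr}(G)}\mathrm{cod}(\chi)$. *)

theory Defs
  imports
    "HOL-Algebra.Elementary_Groups"
    "HOL-Computational_Algebra.Primes"
    "Jordan_Normal_Form.VS_Connect"
begin

definition GL :: "nat \<Rightarrow> complex mat monoid" where
  "GL d = units_of (ring_mat TYPE(complex) d ())"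

definition mat_trace :: "complex mat \<Rightarrow> complex" where
  "mat_trace A = (\<Sum>i<dim_row A. A $$ (i, i))"

definition irreducible_rep ::
  "('a, 'b) monoid_scheme \<Rightarrow> nat \<Rightarrow> ('a \<Rightarrow> complex mat) \<Rightarrow> bool" where
  "irreducible_rep G d \<rho> \<longleftrightarrow>
     d > 0 \<and> \<rho> \<in> hom G (GL d) \<and>
     (\<forall>W. VectorSpace.subspace class_ring W (module_vec TYPE(complex) d) \<longrightarrow>
        (\<forall>g\<in>carrier G. \<forall>w\<in>W. \<rho> g *\<^sub>v w \<in> W) \<longrightarrow>
        W = {0\<^sub>v d} \<or> W = carrier_vec d)"

text \<open>Characters are restricted to the carrier (with value \<open>undefined\<close> outside it), so
  that two of them are equal in HOL exactly when they agree on the group. Hence \<open>Irr G\<close>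
  contains one element per irreducible character.\<close>

definition Irr :: "('a, 'b) monoid_scheme \<Rightarrow> ('a \<Rightarrow> complex) set" where
  "Irr G = {restrict (\<lambda>g. mat_trace (\<rho> g)) (carrier G) | d \<rho>. irreducible_rep G d \<rho>}"

definition char_ker :: "('a, 'b) monoid_scheme \<Rightarrow> ('a \<Rightarrow> complex) \<Rightarrow> 'a set" where
  "char_ker G \<chi> = {g \<in> carrier G. \<chi> g = \<chi> \<one>\<^bsub>G\<^esub>}"

lemma degree_eq_trace_one:
  assumes "group G" and "irreducible_rep G d \<rho>"
  shows "mat_trace (\<rho> \<one>\<^bsub>G\<^esub>) = of_nat d"
proof -
  interpret R: ring "ring_mat TYPE(complex) d ()" by (rule ring_mat)
  have "group (GL d)" unfolding GL_def by (rule R.units_group)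
  then have "\<rho> \<one>\<^bsub>G\<^esub> = \<one>\<^bsub>GL d\<^esub>"
    using assms hom_one unfolding irreducible_rep_def by blast
  then show ?thesis by (simp add: GL_def units_of_def ring_mat_simps mat_trace_def)
qed

text \<open>The degree \<open>\<chi>(1)\<close> is a positive integer (\<open>degree_eq_trace_one\<close>); \<open>Re\<close> only changes
  its type.\<close>

definition cod :: "('a, 'b) monoid_scheme \<Rightarrow> ('a \<Rightarrow> complex) \<Rightarrow> real" where
  "cod G \<chi> = real (card (rcosets\<^bsub>G\<^esub> (char_ker G \<chi>))) / Re (\<chi> \<one>\<^bsub>G\<^esub>)"

definition S_c :: "('a, 'b) monoid_scheme \<Rightarrow> real" where
  "S_c G = (\<Sum>\<chi>\<in>Irr G. cod G \<chi>)"

end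

theory Submission
  imports
    Defs
    "HOL-Number_Theory.Totient"
    "HOL-Algebra.Sylow"
    "HOL-Algebra.Multiplicative_Group"
    "Jordan_Normal_Form.Spectral_Radius"
    "Jordan_Normal_Form.Matrix_Kernel"
begin

text \<open>
  Write \<open>\<psi>(n)\<close> for the sum of the element orders of the cyclic group of order \<open>n\<close>, that is
  \<open>\<psi>(n) = \<Sum>d|n. d \<phi>(d)\<close> (\<open>cyclic_order_sum\<close>). A linear character has as codegree its order in
  the dual group, and a cyclic group is isomorphic to its dual, so \<open>S\<^sub>c(C\<^sub>n)\<close> is at least \<open>\<psi>(n)\<close>
  (\<open>S_c_cyclic_ge\<close>). It remains to bound \<open>S\<^sub>c(G)\<close> by \<open>\<psi>(n)\<close>.

  Let \<open>m\<close> be the number of linear characters of \<open>G\<close>. They form an abelian group of order \<open>m\<close>,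
  and among all abelian groups of a given order the cyclic one has the largest sum of element
  orders (\<open>comm_group_sum_ord_le\<close>); so the linear characters contribute at most \<open>\<psi>(m)\<close>. A
  nonlinear character \<open>\<chi>\<close> has degree at least \<open>2\<close>, hence codegree at most
  \<open>n / \<chi>(1) \<le> (n / 8) \<chi>(1)\<^sup>2\<close>. Since the squares of all the degrees add up to at most \<open>n\<close>, and
  the linear characters account for \<open>m\<close> of this, the nonlinear ones contribute at most
  \<open>(n / 8) (n - m)\<close>. Together (\<open>S_c_le\<close>):

  \<open>S\<^sub>c(G) \<le> \<psi>(m) + (n / 8) (n - m)\<close>.

  Two estimates turn the right-hand side into a convex combination. As \<open>m\<close> divides \<open>n\<close>
  (\<open>card_linear_chars_dvd_order\<close>), \<open>\<psi>(m) \<le> (m / n) \<psi>(n)\<close> (\<open>cyclic_order_sum_mono_ratio\<close>).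
  Further \<open>\<psi>(n) \<ge> n\<^sup>2 \<Prod>p|n. p / (p + 1)\<close>, and a product of \<open>1 + 1 / p\<close> over at most 99 primes
  is at most \<open>8\<close>, so that \<open>n\<^sup>2 / 8 \<le> \<psi>(n)\<close> (\<open>square_le_8_cyclic_order_sum\<close>). Therefore
  \<open>S\<^sub>c(G) \<le> (m / n) \<psi>(n) + (1 - m / n) \<psi>(n) = \<psi>(n)\<close>.

  The representation theory that enters is small. The bound on the squares of the degrees is a
  dimension count: Schur's lemma makes the matrix coefficients of the irreducible representations
  biorthogonal, so there are at most \<open>n\<close> of them. The same bound, applied to \<open>G\<close>, to its dual and
  to the image of \<open>G\<close> in its double dual, shows that this image has exactly \<open>m\<close> elements, and
  therefore that \<open>m\<close> divides \<open>n\<close>.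
\<close>

section \<open>The sum of element orders of a cyclic group\<close>

definition cyclic_order_sum :: "nat \<Rightarrow> nat" where
  "cyclic_order_sum n = (\<Sum>d | d dvd n. d * totient d)"

text \<open>Multiplying divisors of \<open>a\<close> with divisors of \<open>b\<close> is injective for coprime \<open>a\<close> and \<open>b\<close>,
  and \<open>\<phi>\<close> is multiplicative on these products. (The map is also onto, so both sides are in fact
  equal.)\<close>

lemma cyclic_order_sum_mult_le:
  assumes "coprime a b" "a > 0" "b > 0"
  shows "cyclic_order_sum a * cyclic_order_sum b \<le> cyclic_order_sum (a * b)"
proof -
  let ?D = "\<lambda>n. {d :: nat. d dvd n}"
  have cop: "coprime d e" if "d dvd a" "e dvd b" for d e
    using assms(1) that coprime_divisors by blast
  have "cyclic_order_sum a * cyclic_order_sum b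
      = (\<Sum>(d, e) \<in> ?D a \<times> ?D b. (d * totient d) * (e * totient e))"
    unfolding cyclic_order_sum_def sum_product by (simp add: sum.cartesian_product)
  also have "\<dots> = (\<Sum>(d, e) \<in> ?D a \<times> ?D b. (d * e) * totient (d * e))"
    using cop by (intro sum.cong) (auto simp: totient_mult_coprime)
  also have "\<dots> = (\<Sum>x \<in> (\<lambda>(d, e). d * e) ` (?D a \<times> ?D b). x * totient x)"
  proof (subst sum.reindex)
    show "inj_on (\<lambda>(d, e). d * e) (?D a \<times> ?D b)"
    proof (rule inj_onI, clarsimp)
      fix d e d' e' assume *: "d dvd a" "e dvd b" "d' dvd a" "e' dvd b" "d * e = d' * e'"
      have "coprime d e'" "coprime d' e" using * cop by auto
      then have "d dvd d'" "d' dvd d"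
        using *(5) by (metis coprime_dvd_mult_left_iff dvd_triv_left)+
      then have "d = d'" by (rule dvd_antisym)
      moreover have "d > 0" using * assms by (auto intro!: Nat.gr0I)
      ultimately show "d = d' \<and> e = e'" using * by simp
    qed
  qed (auto simp: case_prod_beta)
  also have "\<dots> \<le> (\<Sum>x | x dvd a * b. x * totient x)"
    using assms by (intro sum_mono2) (auto intro: mult_dvd_mono)
  finally show ?thesis unfolding cyclic_order_sum_def .
qed

lemma cyclic_order_sum_prime_power:
  assumes "prime p"
  shows "cyclic_order_sum (p ^ k) * (p + 1) = p ^ (2 * k + 1) + 1"
proof -
  have p: "p > 1" using assms prime_gt_1_nat by blast
  have div: "{d. d dvd p ^ k} = (\<lambda>i. p ^ i) ` {..k}" for k
    using assms by (auto simp: divides_primepow_nat)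
  have inj: "inj_on (\<lambda>i. p ^ i) X" for X
    using p by (auto intro!: inj_onI)
  have eq: "cyclic_order_sum (p ^ k) = (\<Sum>i\<le>k. p ^ i * totient (p ^ i))" for k
    unfolding cyclic_order_sum_def div by (subst sum.reindex[OF inj]) simp
  show ?thesis
  proof (induction k)
    case 0 show ?case by (simp add: cyclic_order_sum_def)
  next
    case (Suc k)
    obtain q where q: "p = Suc q" using p by (cases p) auto
    define x where "x = p ^ k"
    have sq: "p ^ (2 * k) = x * x" by (simp add: x_def mult_2 power_add)
    have "cyclic_order_sum (p ^ Suc k) = cyclic_order_sum (p ^ k) + p * x * (x * (p - 1))"
      unfolding eq using totient_prime_power_Suc[OF assms, of k] by (simp add: x_def)
    then have "cyclic_order_sum (p ^ Suc k) * (p + 1) = cyclic_order_sum (p ^ k) * (p + 1) + p * x * (x * (p - 1)) * (p + 1)"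
      by (simp only: distrib_right)
    also have "\<dots> = p * (x * x) + 1 + p * x * (x * (p - 1)) * (p + 1)"
      using Suc sq by simp
    also have "\<dots> = p * p * p * (x * x) + 1"
      by (simp add: q algebra_simps)
    also have "\<dots> = p ^ (2 * Suc k + 1) + 1"
      using sq by (simp add: mult_ac)
    finally show ?case .
  qed
qed

text \<open>Reindexing the divisors by \<open>d = n div e\<close> gives \<open>\<psi>(n) / n = \<Sum>e|n. \<phi>(n / e) / e\<close>. In
  this form, passing from \<open>m\<close> to a multiple \<open>n\<close> adds divisors \<open>e\<close> and, since \<open>\<phi>(m / e)\<close> divides
  \<open>\<phi>(n / e)\<close>, does not decrease the terms that are already there.\<close>

lemma cyclic_order_sum_mono_ratio:
  assumes "m dvd n" "n > 0"
  shows "real (cyclic_order_sum m) * n \<le> real (cyclic_order_sum n) * m"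
proof -
  have ratio: "real (cyclic_order_sum n) = n * (\<Sum>e | e dvd n. real (totient (n div e)) / e)"
    if "n > 0" for n :: nat
  proof -
    have "real (cyclic_order_sum n) = (\<Sum>e | e dvd n. real ((n div e) * totient (n div e)))"
      unfolding cyclic_order_sum_def of_nat_sum
      by (rule sum.reindex_bij_witness[where i = "\<lambda>e. n div e" and j = "\<lambda>e. n div e"])
        (use that in \<open>auto elim!: dvdE\<close>)
    also have "\<dots> = (\<Sum>e | e dvd n. n * (real (totient (n div e)) / e))"
      by (intro sum.cong) (use that in \<open>auto elim!: dvdE\<close>)
    finally show ?thesis by (simp add: sum_distrib_left)
  qed
  have m: "m > 0" using assms by (auto intro!: Nat.gr0I)
  have "(\<Sum>e | e dvd m. real (totient (m div e)) / e) \<le> (\<Sum>e | e dvd m. real (totient (n div e)) / e)"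
  proof (intro sum_mono divide_right_mono)
    fix e assume "e \<in> {e. e dvd m}"
    then have e: "e dvd m" "e dvd n" using assms by (auto intro: dvd_trans)
    then have "m div e dvd n div e" using assms by (auto intro: div_dvd_div[THEN iffD2])
    then have "totient (m div e) dvd totient (n div e)" by (rule totient_dvd)
    moreover have "n div e > 0" using assms e(2) by (auto elim!: dvdE)
    ultimately show "real (totient (m div e)) \<le> real (totient (n div e))"
      by (simp add: dvd_imp_le)
  qed simp
  also have "\<dots> \<le> (\<Sum>e | e dvd n. real (totient (n div e)) / e)"
    using assms by (intro sum_mono2) (auto intro: dvd_trans)
  finally show ?thesis
    using m assms by (simp add: ratio mult_ac mult_left_mono)
qed

text \<open>This is \<open>\<psi>(n) / n\<^sup>2 \<ge> \<Prod>p|n. p / (p + 1)\<close> without division. For a prime power it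
  comes from \<open>(p + 1) \<psi>(p\<^sup>k) = p\<^bsup>2k+1\<^esup> + 1\<close>, and the general case follows by multiplicativity,
  one prime after the other.\<close>

lemma cyclic_order_sum_ge:
  assumes "n > 0"
  shows "n ^ 2 * (\<Prod>p\<in>prime_factors n. p) \<le> cyclic_order_sum n * (\<Prod>p\<in>prime_factors n. p + 1)"
proof -
  have "(\<Prod>p\<in>S. p ^ k p) ^ 2 * (\<Prod>p\<in>S. p) \<le> cyclic_order_sum (\<Prod>p\<in>S. p ^ k p) * (\<Prod>p\<in>S. p + 1)"
    if "finite S" "\<forall>p\<in>S. prime p" for S :: "nat set" and k
    using that
  proof (induction S rule: finite_induct)
    case empty
    show ?case by (simp add: cyclic_order_sum_def)
  next
    case (insert q S)
    let ?N = "\<Prod>p\<in>S. p ^ k p"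
    have cop: "coprime (q ^ k q) ?N"
    proof (rule prod_coprime_right)
      fix p assume "p \<in> S"
      then have "prime q" "prime p" "p \<noteq> q" using insert by auto
      then show "coprime (q ^ k q) (p ^ k p)"
        by (auto simp: primes_coprime)
    qed
    have pos: "q ^ k q > 0" "?N > 0" using insert.prems by (auto simp: prime_gt_0_nat intro!: prod_pos)
    have "(q ^ k q) ^ 2 * q \<le> cyclic_order_sum (q ^ k q) * (q + 1)"
      using insert.prems cyclic_order_sum_prime_power[of q "k q"]
      by (simp add: power_mult[symmetric] mult.commute)
    moreover have "?N ^ 2 * (\<Prod>p\<in>S. p) \<le> cyclic_order_sum ?N * (\<Prod>p\<in>S. p + 1)"
      using insert.IH insert.prems by simp
    ultimately have "((q ^ k q) ^ 2 * q) * (?N ^ 2 * (\<Prod>p\<in>S. p))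
      \<le> (cyclic_order_sum (q ^ k q) * (q + 1)) * (cyclic_order_sum ?N * (\<Prod>p\<in>S. p + 1))"
      by (rule mult_le_mono)
    also have "\<dots> = (cyclic_order_sum (q ^ k q) * cyclic_order_sum ?N) * ((q + 1) * (\<Prod>p\<in>S. p + 1))"
      by (simp only: mult_ac)
    also have "\<dots> \<le> cyclic_order_sum (q ^ k q * ?N) * ((q + 1) * (\<Prod>p\<in>S. p + 1))"
      by (intro mult_right_mono cyclic_order_sum_mult_le cop pos) auto
    finally show ?case using insert by (simp add: power_mult_distrib mult_ac)
  qed
  from this[of "prime_factors n" "\<lambda>p. multiplicity p n"] show ?thesis
    using assms by (simp add: in_prime_factors_imp_prime prime_factorization_nat[symmetric])
qed

section \<open>A product over at most 99 primes\<close>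

text \<open>The factor \<open>1 + 1 / x\<close> decreases in \<open>x\<close>. Every element of \<open>S - T\<close> exceeds \<open>N\<close>, every
  element of \<open>T - S\<close> is at most \<open>N\<close>, and there are at least as many of the latter; so exchanging
  the former for the latter can only increase the product.\<close>

lemma prod_succ_ratio_exchange:
  fixes S T :: "nat set"
  assumes "finite S" "finite T" "card S \<le> card T" "0 \<notin> S" "0 \<notin> T"
    and T: "\<And>x. x \<in> T \<Longrightarrow> x \<le> N" and S: "\<And>x. x \<in> S \<Longrightarrow> x \<le> N \<Longrightarrow> x \<in> T"
  shows "(\<Prod>x\<in>S. 1 + 1 / real x) \<le> (\<Prod>x\<in>T. 1 + 1 / real x)"
proof -
  let ?f = "\<lambda>x. 1 + 1 / real x" and ?c = "1 + 1 / (real N + 1)"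
  have card: "card (S - T) \<le> card (T - S)"
    using assms by (metis card_le_sym_Diff)
  have "(\<Prod>x\<in>S. ?f x) = (\<Prod>x\<in>S \<inter> T. ?f x) * (\<Prod>x\<in>S - T. ?f x)"
    using assms(1) by (metis prod.Int_Diff)
  also have "(\<Prod>x\<in>S - T. ?f x) \<le> (\<Prod>x\<in>S - T. ?c)"
  proof (intro prod_mono conjI)
    fix x assume "x \<in> S - T"
    then have "real N + 1 \<le> real x" using S[of x] by force
    then show "?f x \<le> ?c" by (intro add_left_mono divide_left_mono) auto
  qed auto
  also have "\<dots> \<le> (\<Prod>x\<in>T - S. ?c)"
    using card by (simp add: power_increasing)
  also have "\<dots> \<le> (\<Prod>x\<in>T - S. ?f x)"
  proof (intro prod_mono conjI)
    fix x assume "x \<in> T - S"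
    then have "0 < real x" "real x \<le> real N + 1" using T[of x] assms(5) by (force intro: Nat.gr0I)+
    then show "?c \<le> ?f x" by (intro add_left_mono divide_left_mono) auto
  qed auto
  also have "(\<Prod>x\<in>S \<inter> T. ?f x) * (\<Prod>x\<in>T - S. ?f x) = (\<Prod>x\<in>T. ?f x)"
    using assms(2) by (metis inf_commute prod.Int_Diff)
  finally show ?thesis by (simp add: mult_left_mono prod_nonneg)
qed

text \<open>The primes are compared with the 99 numbers up to 361 that are either 2, 3 or 5, or
  greater than 1 and coprime to 30. They include all primes up to 361, and their product of
  \<open>1 + 1 / x\<close> is about 7.51.\<close>

lemma prod_succ_primes_le:
  fixes S :: "nat set"
  assumes "finite S" "\<And>p. p \<in> S \<Longrightarrow> prime p" "card S \<le> 99"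
  shows "(\<Prod>p\<in>S. p + 1) \<le> 8 * (\<Prod>p\<in>S. p)"
proof -
  \<comment> \<open>Integers, because their binary numerals keep the evaluation of the two products short.\<close>
  define R where "R = [7..361 :: int]"
  define U where "U = [2, 3, 5] @ filter (\<lambda>x :: int. odd x \<and> x mod 3 \<noteq> 0 \<and> x mod 5 \<noteq> 0) R"
  have R: "set R = {7..361}" "distinct R" unfolding R_def by (rule set_upto, rule distinct_upto)
  define T where "T = nat ` set U"
  have dist: "distinct U" unfolding U_def using R by auto
  have val: "length U = 99" "prod_list (map (\<lambda>x. x + 1) U) \<le> 8 * prod_list U"
    unfolding U_def R_def by code_simp+
  have U_bounds: "0 < x \<and> x \<le> 361" if "x \<in> set U" for x using that R unfolding U_def by auto
  have inj: "inj_on nat (set U)" using U_bounds by (auto intro!: inj_onI simp: eq_nat_nat_iff less_imp_le)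
  have T0: "0 \<notin> T" unfolding T_def using U_bounds by force
  have inT: "x \<in> T" if "x \<in> S" "x \<le> 361" for x
  proof -
    have prime: "prime x" using assms(2) that by blast
    have "int x \<in> set U"
    proof (cases "odd x \<and> x mod 3 \<noteq> 0 \<and> x mod 5 \<noteq> 0")
      case True
      have "x \<noteq> 1" "x \<noteq> 0" using prime by auto
      moreover have "x \<noteq> 2" "x \<noteq> 3" "x \<noteq> 4" "x \<noteq> 5" "x \<noteq> 6" using True by auto
      ultimately have "x \<ge> 7" by linarith
      moreover have "int x mod 3 \<noteq> 0" "int x mod 5 \<noteq> 0" using True by presburger+
      ultimately show ?thesis using True that R unfolding U_def by auto
    next
      case False
      then have "2 dvd x \<or> 3 dvd x \<or> 5 dvd x" by auto
      then have "x = 2 \<or> x = 3 \<or> x = 5"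
        using prime primes_dvd_imp_eq[of 2 x] primes_dvd_imp_eq[of 3 x] primes_dvd_imp_eq[of 5 x]
        by auto
      then show ?thesis unfolding U_def by auto
    qed
    then show ?thesis unfolding T_def by force
  qed
  have pos: "0 \<notin> S" using assms(2) by force
  have "(\<Prod>p\<in>S. 1 + 1 / real p) \<le> (\<Prod>p\<in>T. 1 + 1 / real p)"
  proof (rule prod_succ_ratio_exchange[where N = 361])
    show "card S \<le> card T" unfolding T_def using assms val dist inj by (simp add: card_image distinct_card)
    show "x \<le> 361" if "x \<in> T" for x using that U_bounds unfolding T_def by force
    show "finite T" unfolding T_def by simp
  qed (use assms T0 inT pos in auto)
  also have "(\<Prod>p\<in>T. 1 + 1 / real p) = (\<Prod>u\<in>set U. real_of_int (u + 1) / real_of_int u)"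
    unfolding T_def using inj U_bounds
    by (subst prod.reindex) (auto intro!: prod.cong simp: field_simps dest: U_bounds)
  also have "\<dots> = real_of_int (\<Prod>u\<in>set U. u + 1) / real_of_int (\<Prod>u\<in>set U. u)"
    by (simp add: prod_dividef)
  also have "\<dots> = real_of_int (prod_list (map (\<lambda>x. x + 1) U)) / real_of_int (prod_list U)"
    using dist by (simp add: prod.distinct_set_conv_list)
  also have "\<dots> \<le> 8"
  proof -
    have "prod_list U > 0"
      using U_bounds dist by (metis prod.distinct_set_conv_list list.map_ident prod_pos)
    moreover have "real_of_int (prod_list (map (\<lambda>x. x + 1) U)) \<le> real_of_int (8 * prod_list U)"
      using val(2) of_int_le_iff by blast
    ultimately show ?thesis by (simp add: divide_simps)
  qed
  finally have "(\<Prod>p\<in>S. 1 + 1 / real p) \<le> 8" .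
  moreover have "(\<Prod>p\<in>S. 1 + 1 / real p) = real (\<Prod>p\<in>S. p + 1) / real (\<Prod>p\<in>S. p)"
  proof -
    have "1 + 1 / real p = real (p + 1) / real p" if "p \<in> S" for p
      using that pos by (cases "p = 0") (auto simp: field_simps)
    then show ?thesis unfolding of_nat_prod prod_dividef[symmetric] by (intro prod.cong refl)
  qed
  moreover have "real (\<Prod>p\<in>S. p) > 0"
    using pos by (auto intro!: prod_pos Nat.gr0I)
  ultimately have "real (\<Prod>p\<in>S. p + 1) \<le> 8 * real (\<Prod>p\<in>S. p)"
    by (metis pos_divide_le_eq)
  then show ?thesis by (metis of_nat_le_iff of_nat_mult of_nat_numeral)
qed

lemma square_le_8_cyclic_order_sum:
  assumes "n > 0" "card (prime_factors n) \<le> 99"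
  shows "n ^ 2 \<le> 8 * cyclic_order_sum n"
proof -
  let ?P = "\<Prod>p\<in>prime_factors n. p"
  have "n ^ 2 * ?P \<le> cyclic_order_sum n * (\<Prod>p\<in>prime_factors n. p + 1)"
    by (rule cyclic_order_sum_ge[OF assms(1)])
  also have "\<dots> \<le> cyclic_order_sum n * (8 * ?P)"
    using assms(2) by (intro mult_left_mono prod_succ_primes_le) (auto simp: in_prime_factors_imp_prime)
  finally have "n ^ 2 * ?P \<le> (8 * cyclic_order_sum n) * ?P" by (simp add: mult_ac)
  moreover have "?P > 0" by (intro prod_pos) (auto simp: in_prime_factors_iff prime_gt_0_nat)
  ultimately show ?thesis by simp
qed

section \<open>Element orders in finite abelian groups\<close>

lemma coprime_if_no_common_prime:
  fixes a b :: nat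
  assumes "\<And>p. prime p \<Longrightarrow> p dvd a \<Longrightarrow> p dvd b \<Longrightarrow> False"
  shows "coprime a b"
proof (rule ccontr)
  assume "\<not> coprime a b"
  then obtain p where "prime p" "p dvd gcd a b"
    using prime_factor_nat[of "gcd a b"] by (auto simp: coprime_iff_gcd_eq_1)
  then show False using assms by auto
qed

text \<open>By Sylow's theorem some element has order \<open>p\<close>.\<close>

lemma (in group) prime_dvd_exponent:
  assumes "finite (carrier G)" "\<And>x. x \<in> carrier G \<Longrightarrow> x [^] (d::nat) = \<one>" "prime p" "p dvd Coset.order G"
  shows "p dvd d"
proof -
  obtain k where k: "Coset.order G = p ^ 1 * k" using assms(4) by (auto elim: dvdE)
  obtain H where H: "subgroup H G" "card H = p"
    using sylow_thm[OF assms(3) is_group k assms(1)] by auto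
  have "card H > 1" using H assms(3) prime_gt_1_nat by metis
  then have "\<not> H \<subseteq> {\<one>}" using card_mono[of "{\<one>}" H] by fastforce
  then obtain x where x: "x \<in> H" "x \<noteq> \<one>" by blast
  interpret H: group "G\<lparr>carrier := H\<rparr>" using subgroup.subgroup_is_group[OF H(1) is_group] .
  have xG: "x \<in> carrier G" using H x subgroup.mem_carrier by metis
  have "x [^]\<^bsub>G\<lparr>carrier := H\<rparr>\<^esub> Coset.order (G\<lparr>carrier := H\<rparr>) = \<one>"
    using H.pow_order_eq_1[of x] x by simp
  then have "x [^] p = \<one>" using H by (simp add: Coset.order_def nat_pow_consistent[symmetric])
  then have "ord x dvd p" using pow_eq_id xG by blast
  moreover have "ord x \<noteq> 1" using x xG ord_eq_1 by blast
  ultimately have "ord x = p" using assms(3) prime_nat_iff by blast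
  then show ?thesis using assms(2)[OF xG] pow_eq_id[OF xG] by blast
qed

text \<open>By Sylow's theorem there is a subgroup of order \<open>p\<^sup>i\<close>, and all its elements satisfy the
  equation.\<close>

lemma (in group) card_pow_eq_one_ge:
  assumes "finite (carrier G)" "prime p" "p ^ i dvd Coset.order G"
  shows "p ^ i \<le> card {x \<in> carrier G. x [^] (p ^ i) = \<one>}"
proof -
  obtain m where "Coset.order G = p ^ i * m" using assms(3) by (auto elim: dvdE)
  then obtain H where H: "subgroup H G" "card H = p ^ i"
    using sylow_thm[OF assms(2) is_group _ assms(1)] by blast
  interpret H: group "G\<lparr>carrier := H\<rparr>" using subgroup.subgroup_is_group[OF H(1) is_group] .
  have "x [^] (p ^ i) = \<one>" if "x \<in> H" for x
    using H.pow_order_eq_1[of x] that H by (simp add: Coset.order_def nat_pow_consistent[symmetric])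
  then have "H \<subseteq> {x \<in> carrier G. x [^] (p ^ i) = \<one>}"
    using subgroup.subset[OF H(1)] by blast
  then have "card H \<le> card {x \<in> carrier G. x [^] (p ^ i) = \<one>}"
    using assms(1) by (intro card_mono) auto
  then show ?thesis using H by simp
qed

text \<open>In a group of order \<open>p\<^sup>k\<close> the order of \<open>x\<close> is \<open>p\<^sup>k\<close> minus the sum of the increments
  \<open>p\<^bsup>i+1\<^esup> - p\<^sup>i\<close> over those \<open>i < k\<close> for which \<open>x\<close> to the power \<open>p\<^sup>i\<close> is the identity. So the sum
  of the orders is largest when the equations have as few solutions as possible. There are at
  least \<open>p\<^sup>i\<close> solutions, which is their number in a cyclic group.\<close>

lemma (in group) sum_ord_prime_power_le:
  assumes "finite (carrier G)" "prime p" "Coset.order G = p ^ k"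
  shows "(\<Sum>x\<in>carrier G. ord x) \<le> cyclic_order_sum (p ^ k)"
proof -
  have p: "p > 1" using assms prime_gt_1_nat by blast
  \<comment> \<open>The weights with which the solution counts enter; they are not negative.\<close>
  define w where "w i = (int p ^ Suc i - int p ^ i)" for i
  have w: "w i \<ge> 0" for i using p unfolding w_def by simp
  have tele: "(\<Sum>i\<in>{j..<k}. w i) = int p ^ k - int p ^ j" if "j \<le> k" for j
    unfolding w_def using that by (rule sum_Suc_diff')
  have ord: "int (ord x) = int p ^ k - (\<Sum>i<k. w i * of_bool (x [^] (p ^ i) = \<one>))"
    if "x \<in> carrier G" for x
  proof -
    have "ord x dvd p ^ k" using that assms ord_dvd_group_order by metis
    then obtain j where j: "j \<le> k" "ord x = p ^ j" using assms(2) divides_primepow_nat by blast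
    have "x [^] (p ^ i) = \<one> \<longleftrightarrow> j \<le> i" for i
      unfolding pow_eq_id[OF that] j using p by (subst dvd_power_iff_le) auto
    then have "(\<Sum>i<k. w i * of_bool (x [^] (p ^ i) = \<one>)) = (\<Sum>i\<in>{j..<k}. w i)"
      by (intro sum.mono_neutral_cong_right) auto
    then show ?thesis using tele[OF j(1)] j by simp
  qed
  have "int (\<Sum>x\<in>carrier G. ord x) = (\<Sum>x\<in>carrier G. int p ^ k - (\<Sum>i<k. w i * of_bool (x [^] (p ^ i) = \<one>)))"
    unfolding of_nat_sum by (intro sum.cong refl ord)
  also have "\<dots> = int p ^ k * int p ^ k - (\<Sum>i<k. w i * (\<Sum>x\<in>carrier G. of_bool (x [^] (p ^ i) = \<one>)))"
    using assms(3) unfolding sum_subtractf Coset.order_def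
    by (subst sum.swap) (simp add: sum_distrib_left)
  also have "\<dots> \<le> int p ^ k * int p ^ k - (\<Sum>i<k. w i * int p ^ i)"
  proof (intro diff_left_mono sum_mono mult_left_mono w)
    fix i assume "i \<in> {..<k}"
    then have "p ^ i \<le> card {x \<in> carrier G. x [^] (p ^ i) = \<one>}"
      using assms by (intro card_pow_eq_one_ge) (auto simp: le_imp_power_dvd)
    also have "int (card {x \<in> carrier G. x [^] (p ^ i) = \<one>}) = (\<Sum>x\<in>carrier G. of_bool (x [^] (p ^ i) = \<one>))"
      using assms(1) by (simp add: sum.If_cases of_bool_def Int_def)
    finally show "int p ^ i \<le> (\<Sum>x\<in>carrier G. of_bool (x [^] (p ^ i) = \<one>))" by simp
  qed
  also have "\<dots> = int (cyclic_order_sum (p ^ k))"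
  proof -
    have "(\<Sum>i<j. w i * int p ^ i) * (int p + 1) = int p ^ j * int p ^ j - 1" for j
    proof (induction j)
      case (Suc j)
      define z where "z = int p ^ j"
      show ?case using Suc unfolding w_def z_def[symmetric] by (simp add: z_def[symmetric] algebra_simps)
    qed simp
    then have "(int p ^ k * int p ^ k - (\<Sum>i<k. w i * int p ^ i)) * (int p + 1)
        = int p ^ k * int p ^ k * (int p + 1) - (int p ^ k * int p ^ k - 1)"
      by (simp only: left_diff_distrib)
    also have "\<dots> = int p ^ (2 * k + 1) + 1"
      by (simp add: algebra_simps mult_2_right power_add)
    also have "\<dots> = int (cyclic_order_sum (p ^ k) * (p + 1))"
      unfolding cyclic_order_sum_prime_power[OF assms(2)] by simp
    also have "\<dots> = int (cyclic_order_sum (p ^ k)) * (int p + 1)"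
      by (simp only: of_nat_mult of_nat_add of_nat_1)
    finally show ?thesis by (subst (asm) mult_right_cancel) auto
  qed
  finally show ?thesis by (simp only: of_nat_le_iff)
qed

lemma (in comm_group) subgroup_pow_eq_one: "subgroup {x \<in> carrier G. x [^] (d::nat) = \<one>} G"
  by (rule subgroupI) (auto simp: pow_mult_distrib m_comm nat_pow_inv)

text \<open>An abelian group of order \<open>ab\<close> with coprime \<open>a\<close> and \<open>b\<close> is the direct product of the
  solutions of \<open>x\<^sup>a = 1\<close> and of \<open>x\<^sup>b = 1\<close>. The cardinalities of the two factors are determined by
  the fact that a prime dividing the order of a finite group also divides every exponent of it.\<close>

lemma (in comm_group) sum_ord_coprime_split:
  assumes fin: "finite (carrier G)" and ord_eq: "Coset.order G = a * b" and cop: "coprime a b"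
  defines "P \<equiv> {x \<in> carrier G. x [^] a = \<one>}" and "Q \<equiv> {x \<in> carrier G. x [^] b = \<one>}"
  shows "card P = a" "card Q = b"
    and "(\<Sum>x\<in>carrier G. ord x) \<le> (\<Sum>x\<in>P. ord x) * (\<Sum>x\<in>Q. ord x)"
proof -
  have sub: "subgroup P G" "subgroup Q G" unfolding P_def Q_def by (rule subgroup_pow_eq_one)+
  have PQ: "P \<subseteq> carrier G" "Q \<subseteq> carrier G" "finite P" "finite Q"
    unfolding P_def Q_def using fin by auto
  have trivial: "x = \<one>" if "x \<in> P" "x \<in> Q" for x
  proof -
    have x: "x \<in> carrier G" using that PQ by blast
    then have "ord x dvd a" "ord x dvd b" using that pow_eq_id unfolding P_def Q_def by auto
    then have "ord x = 1" using cop coprime_common_divisor_nat by blast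
    then show ?thesis using x ord_eq_1 by blast
  qed
  let ?m = "\<lambda>(x, y). x \<otimes> y"
  have surj: "?m ` (P \<times> Q) = carrier G"
  proof (rule antisym)
    show "carrier G \<subseteq> ?m ` (P \<times> Q)"
    proof
      fix x assume x: "x \<in> carrier G"
      \<comment> \<open>With \<open>u a + v b = 1\<close>, the element \<open>x\<close> is the product of its powers with exponents
        \<open>v b\<close> and \<open>u a\<close>.\<close>
      obtain u v where uv: "u * int a + v * int b = 1"
        using cop bezout_int[of "int a" "int b"] by (auto simp: coprime_iff_gcd_eq_1)
      have 1: "x [^] (int (a * b)) = \<one>" using pow_order_eq_1[OF x] unfolding ord_eq int_pow_int .
      have "(x [^] (v * int b)) [^] a = (x [^] (int (a * b))) [^] v"
        using x by (simp add: int_pow_int[symmetric] int_pow_pow mult_ac)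
      then have "x [^] (v * int b) \<in> P" unfolding P_def using x 1 by simp
      moreover
      have "(x [^] (u * int a)) [^] b = (x [^] (int (a * b))) [^] u"
        using x by (simp add: int_pow_int[symmetric] int_pow_pow mult_ac)
      then have "x [^] (u * int a) \<in> Q" unfolding Q_def using x 1 by simp
      moreover have "x = x [^] (v * int b) \<otimes> x [^] (u * int a)"
        using x uv by (simp add: int_pow_mult[symmetric] add.commute)
      ultimately show "x \<in> ?m ` (P \<times> Q)" by force
    qed
  qed (use PQ in auto)
  have inj: "inj_on ?m (P \<times> Q)"
  proof (rule inj_onI, clarsimp)
    fix x y x' y' assume *: "x \<in> P" "y \<in> Q" "x' \<in> P" "y' \<in> Q" "x \<otimes> y = x' \<otimes> y'"
    then have G: "x \<in> carrier G" "y \<in> carrier G" "x' \<in> carrier G" "y' \<in> carrier G" using PQ by auto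
    have eq: "inv x' \<otimes> x = y' \<otimes> inv y"
      using *(5) G by (metis inv_closed inv_solve_left inv_solve_right m_assoc m_closed)
    have "inv x' \<otimes> x \<in> P" using sub(1) * by (simp add: subgroup.m_closed subgroup.m_inv_closed)
    moreover have "y' \<otimes> inv y \<in> Q" using sub(2) * by (simp add: subgroup.m_closed subgroup.m_inv_closed)
    ultimately have "inv x' \<otimes> x = \<one>" "y' \<otimes> inv y = \<one>" using trivial eq by auto
    then show "x = x' \<and> y = y'" using G by (metis inv_equality inv_inv inv_closed l_inv_ex inv_comm)
  qed
  have card: "card P * card Q = a * b"
    using card_image[OF inj] ord_eq unfolding surj Coset.order_def by (simp add: card_cartesian_product)
  have "coprime (card P) b"
  proof (rule coprime_if_no_common_prime)
    interpret P: group "G\<lparr>carrier := P\<rparr>" using subgroup.subgroup_is_group[OF sub(1) is_group] .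
    fix p assume p: "prime p" "p dvd card P" "p dvd b"
    then have "p dvd a"
      using P.prime_dvd_exponent[of a p] PQ by (simp add: Coset.order_def nat_pow_consistent[symmetric] P_def)
    then show False using p cop by (meson coprime_common_divisor not_prime_unit)
  qed
  moreover have "coprime (card Q) a"
  proof (rule coprime_if_no_common_prime)
    interpret Q: group "G\<lparr>carrier := Q\<rparr>" using subgroup.subgroup_is_group[OF sub(2) is_group] .
    fix p assume p: "prime p" "p dvd card Q" "p dvd a"
    then have "p dvd b"
      using Q.prime_dvd_exponent[of b p] PQ by (simp add: Coset.order_def nat_pow_consistent[symmetric] Q_def)
    then show False using p cop by (meson coprime_common_divisor not_prime_unit)
  qed
  ultimately have cop': "coprime (card P) b" "coprime (card Q) a" by auto
  have "card P dvd a" "card Q dvd b"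
    using card cop' by (metis coprime_dvd_mult_left_iff dvd_triv_left, metis coprime_dvd_mult_right_iff dvd_triv_right)
  moreover have "a dvd card P" "b dvd card Q"
    using card cop' coprime_dvd_mult_left_iff[of a "card Q" "card P"] coprime_dvd_mult_right_iff[of b "card P" "card Q"]
    by (auto simp: coprime_commute)
  ultimately show "card P = a" "card Q = b" by (simp_all add: dvd_antisym)
  have "(\<Sum>x\<in>carrier G. ord x) = (\<Sum>(x, y)\<in>P \<times> Q. ord (x \<otimes> y))"
    unfolding surj[symmetric] by (subst sum.reindex[OF inj]) (simp add: case_prod_beta)
  also have "\<dots> \<le> (\<Sum>(x, y)\<in>P \<times> Q. ord x * ord y)"
  proof (intro sum_mono, clarsimp)
    fix x y assume "x \<in> P" "y \<in> Q"
    then have G: "x \<in> carrier G" "y \<in> carrier G" using PQ by auto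
    then show "ord (x \<otimes> y) \<le> ord x * ord y"
      using abelian_ord_mul_divides[OF G] fin ord_ge_1 by (intro dvd_imp_le) (auto simp: Suc_le_eq)
  qed
  also have "\<dots> = (\<Sum>x\<in>P. ord x) * (\<Sum>x\<in>Q. ord x)"
    by (simp add: sum_product sum.cartesian_product)
  finally show "(\<Sum>x\<in>carrier G. ord x) \<le> (\<Sum>x\<in>P. ord x) * (\<Sum>x\<in>Q. ord x)" .
qed

lemma ord_subgroup:
  assumes "group G" "subgroup H G" "x \<in> H"
  shows "group.ord (G\<lparr>carrier := H\<rparr>) x = group.ord G x"
proof -
  interpret G: group G by fact
  interpret H: group "G\<lparr>carrier := H\<rparr>" using subgroup.subgroup_is_group[OF assms(2,1)] .
  show ?thesis
    using assms G.pow_eq_id[of x] subgroup.mem_carrier[OF assms(2,3)]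
    by (subst H.ord_unique) (auto simp: G.nat_pow_consistent[symmetric])
qed

text \<open>The inductive step of the next theorem: split off the Sylow subgroup of a prime divisor and
  apply the hypothesis to its complement, the elements of order prime to \<open>p\<close>.\<close>

lemma (in comm_group) sum_ord_le_step:
  assumes fin: "finite (carrier G)"
    and IH: "\<And>H. subgroup H G \<Longrightarrow> card H < Coset.order G \<Longrightarrow> (\<Sum>x\<in>H. ord x) \<le> cyclic_order_sum (card H)"
  shows "(\<Sum>x\<in>carrier G. ord x) \<le> cyclic_order_sum (Coset.order G)"
proof (cases "Coset.order G = 1")
  case True
  then obtain x where x: "carrier G = {x}" by (auto simp: Coset.order_def card_1_singleton_iff)
  then have "x = \<one>" using one_closed by simp
  then show ?thesis using x True by (simp add: cyclic_order_sum_def)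
next
  case False
  have pos: "Coset.order G > 0" using fin order_gt_0_iff_finite by blast
  obtain p where p: "prime p" "p dvd Coset.order G" using False prime_factor_nat by blast
  define k where "k = multiplicity p (Coset.order G)"
  obtain b where b: "Coset.order G = p ^ k * b" "\<not> p dvd b"
    using multiplicity_decompose'[of "Coset.order G" p] pos p unfolding k_def
    by (metis not_prime_unit neq0_conv)
  have cop: "coprime (p ^ k) b" using b p by (simp add: prime_imp_coprime)
  have k: "k > 0" using b p by (intro Nat.gr0I) simp
  then have pk: "p ^ k > 1" using p prime_gt_1_nat one_less_power by blast
  let ?P = "{x \<in> carrier G. x [^] (p ^ k) = \<one>}" and ?Q = "{x \<in> carrier G. x [^] b = \<one>}"
  note split = sum_ord_coprime_split[OF fin b(1) cop]
  have sub: "subgroup ?P G" "subgroup ?Q G" by (rule subgroup_pow_eq_one)+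
  have P: "(\<Sum>x\<in>?P. ord x) \<le> cyclic_order_sum (p ^ k)"
  proof -
    let ?GP = "G\<lparr>carrier := ?P\<rparr>"
    interpret P: group ?GP using subgroup.subgroup_is_group[OF sub(1) is_group] .
    have "(\<Sum>x\<in>?P. ord x) = (\<Sum>x\<in>carrier ?GP. P.ord x)"
      by (intro sum.cong) (auto simp: ord_subgroup[OF is_group sub(1)])
    also have "\<dots> \<le> cyclic_order_sum (p ^ k)"
      using fin p(1) split(1) by (intro P.sum_ord_prime_power_le) (auto simp: Coset.order_def)
    finally show ?thesis .
  qed
  have Q: "(\<Sum>x\<in>?Q. ord x) \<le> cyclic_order_sum b"
    using IH[OF sub(2)] split(2) b pk pos by simp
  have "(\<Sum>x\<in>?P. ord x) * (\<Sum>x\<in>?Q. ord x) \<le> cyclic_order_sum (p ^ k) * cyclic_order_sum b"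
    using P Q by (rule mult_le_mono)
  also have "\<dots> \<le> cyclic_order_sum (Coset.order G)"
    unfolding b(1) using pk pos b(1) by (intro cyclic_order_sum_mult_le cop) (auto intro: Nat.gr0I)
  finally show ?thesis using split(3) by linarith
qed

theorem comm_group_sum_ord_le:
  assumes "comm_group G" "finite (carrier G)"
  shows "(\<Sum>x\<in>carrier G. group.ord G x) \<le> cyclic_order_sum (Coset.order G)"
  using assms
proof (induction "Coset.order G" arbitrary: G rule: less_induct)
  case (less A)
  interpret comm_group A by fact
  show ?case
  proof (rule sum_ord_le_step)
    show "finite (carrier A)" by fact
    fix H assume H: "subgroup H A" "card H < Coset.order A"
    let ?AH = "A\<lparr>carrier := H\<rparr>"
    have "comm_group ?AH"
      using H(1) subgroup.mem_carrier[OF H(1)]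
      by (intro group.group_comm_groupI subgroup.subgroup_is_group) (auto simp: m_comm is_group)
    moreover have "finite H" using subgroup.subset[OF H(1)] less.prems(2) by (rule finite_subset)
    ultimately have "(\<Sum>x\<in>carrier ?AH. group.ord ?AH x) \<le> cyclic_order_sum (Coset.order ?AH)"
      using less.hyps[of ?AH] H by (simp add: Coset.order_def)
    then show "(\<Sum>x\<in>H. ord x) \<le> cyclic_order_sum (card H)"
      using ord_subgroup[OF is_group H(1)] by (simp add: Coset.order_def)
  qed
qed

section \<open>Schur orthogonality of matrix coefficients\<close>

text \<open>If \<open>I\<close> were larger than \<open>S\<close>, padding the matrices \<open>(f a s)\<close> and \<open>(h b s)\<close> with zeros
  to square ones would give matrices with product \<open>1\<close>, one of which has a zero column.\<close>

lemma card_le_biorthogonal: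
  fixes f h :: "'i \<Rightarrow> 's \<Rightarrow> complex"
  assumes "finite I" "finite S"
    and dual: "\<And>a b. a \<in> I \<Longrightarrow> b \<in> I \<Longrightarrow> (\<Sum>s\<in>S. f a s * h b s) = of_bool (a = b)"
  shows "card I \<le> card S"
proof (rule ccontr)
  assume "\<not> card I \<le> card S"
  define N where "N = card I"
  have lt: "card S < N" using \<open>\<not> _\<close> unfolding N_def by simp
  obtain e where e: "bij_betw e {0..<N} I" using ex_bij_betw_nat_finite[OF assms(1)] unfolding N_def by blast
  obtain u where u: "bij_betw u {0..<card S} S" using ex_bij_betw_nat_finite[OF assms(2)] by blast
  let ?F = "mat N N (\<lambda>(i, j). if j < card S then f (e i) (u j) else 0)"
  let ?H = "mat N N (\<lambda>(j, i). if j < card S then h (e i) (u j) else 0)"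
  have "?F * ?H = 1\<^sub>m N"
  proof (rule eq_matI)
    fix i k assume ik: "i < dim_row (1\<^sub>m N :: complex mat)" "k < dim_col (1\<^sub>m N :: complex mat)"
    then have mem: "e i \<in> I" "e k \<in> I" using e bij_betwE by fastforce+
    have "(?F * ?H) $$ (i, k) = (\<Sum>j = 0..<N. (if j < card S then f (e i) (u j) * h (e k) (u j) else 0))"
      using ik by (auto simp: scalar_prod_def intro!: sum.cong)
    also have "\<dots> = (\<Sum>j\<in>{0..<card S}. f (e i) (u j) * h (e k) (u j))"
      using lt by (intro sum.mono_neutral_cong_right) auto
    also have "\<dots> = (\<Sum>s\<in>S. f (e i) s * h (e k) s)"
      by (rule sum.reindex_bij_betw[OF u])
    also have "\<dots> = of_bool (i = k)"
      using dual[OF mem] e ik by (auto simp: bij_betw_def inj_on_eq_iff)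
    finally show "(?F * ?H) $$ (i, k) = 1\<^sub>m N $$ (i, k)" using ik by simp
  qed auto
  then have "det ?F * det ?H = 1" by (subst det_mult[of _ N, symmetric]) auto
  moreover have "det ?F = 0"
    using lt by (subst laplace_expansion_column[of _ N "card S"]) auto
  ultimately show False by simp
qed

lemma irreducible_repD:
  assumes "group G" "irreducible_rep G d \<rho>"
  shows "d > 0" "g \<in> carrier G \<Longrightarrow> \<rho> g \<in> carrier_mat d d"
    and "g \<in> carrier G \<Longrightarrow> h \<in> carrier G \<Longrightarrow> \<rho> (g \<otimes>\<^bsub>G\<^esub> h) = \<rho> g * \<rho> h"
    and "\<rho> \<one>\<^bsub>G\<^esub> = 1\<^sub>m d"
proof -
  have hom: "\<rho> \<in> hom G (GL d)" and "d > 0" using assms(2) unfolding irreducible_rep_def by auto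
  then show "d > 0" by simp
  show "g \<in> carrier G \<Longrightarrow> \<rho> g \<in> carrier_mat d d"
    using hom by (auto simp: hom_def GL_def units_of_def Units_def ring_mat_simps)
  show "g \<in> carrier G \<Longrightarrow> h \<in> carrier G \<Longrightarrow> \<rho> (g \<otimes>\<^bsub>G\<^esub> h) = \<rho> g * \<rho> h"
    using hom by (auto simp: hom_def GL_def units_of_def ring_mat_simps)
  interpret R: ring "ring_mat TYPE(complex) d ()" by (rule ring_mat)
  have "group (GL d)" unfolding GL_def by (rule R.units_group)
  then have "\<rho> \<one>\<^bsub>G\<^esub> = \<one>\<^bsub>GL d\<^esub>" using assms(1) hom hom_one by blast
  then show "\<rho> \<one>\<^bsub>G\<^esub> = 1\<^sub>m d" by (simp add: GL_def units_of_def ring_mat_simps)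
qed

lemma subspace_module_vecI:
  assumes "W \<subseteq> carrier_vec d" "0\<^sub>v d \<in> W"
    and "\<And>v w. v \<in> W \<Longrightarrow> w \<in> W \<Longrightarrow> v + w \<in> W" and "\<And>c v. v \<in> W \<Longrightarrow> c \<cdot>\<^sub>v v \<in> W"
  shows "VectorSpace.subspace class_ring W (module_vec TYPE(complex) d)"
proof (rule subspace.intro[OF vec_vs], rule submodule.intro[OF vec_module])
qed (use assms in \<open>simp_all only: module_vec_simps\<close>)

lemma irreducible_rep_invariant:
  assumes "irreducible_rep G d \<rho>"
    and "W \<subseteq> carrier_vec d" "0\<^sub>v d \<in> W"
    and "\<And>v w. v \<in> W \<Longrightarrow> w \<in> W \<Longrightarrow> v + w \<in> W" "\<And>c v. v \<in> W \<Longrightarrow> c \<cdot>\<^sub>v v \<in> W"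
    and "\<And>g w. g \<in> carrier G \<Longrightarrow> w \<in> W \<Longrightarrow> \<rho> g *\<^sub>v w \<in> W"
  shows "W = {0\<^sub>v d} \<or> W = carrier_vec d"
proof -
  have "VectorSpace.subspace class_ring W (module_vec TYPE(complex) d)"
    using assms(2-5) by (rule subspace_module_vecI)
  moreover have "\<forall>g\<in>carrier G. \<forall>w\<in>W. \<rho> g *\<^sub>v w \<in> W" using assms(6) by blast
  ultimately show ?thesis using assms(1) unfolding irreducible_rep_def by meson
qed

lemma kernel_of_intertwiner:
  fixes T :: "complex mat"
  assumes "group G" "irreducible_rep G e \<sigma>"
    and \<rho>: "\<And>g. g \<in> carrier G \<Longrightarrow> \<rho> g \<in> carrier_mat d d"
    and T: "T \<in> carrier_mat d e" "\<And>g. g \<in> carrier G \<Longrightarrow> \<rho> g * T = T * \<sigma> g"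
  shows "mat_kernel T = {0\<^sub>v e} \<or> mat_kernel T = carrier_vec e"
proof (rule irreducible_rep_invariant[OF assms(2)])
  note \<sigma> = irreducible_repD[OF assms(1,2)]
  show "mat_kernel T \<subseteq> carrier_vec e" using T(1) by (rule mat_kernel_carrier)
  show "0\<^sub>v e \<in> mat_kernel T" using T(1) by (auto simp: mat_kernel_def)
  show "v + w \<in> mat_kernel T" if "v \<in> mat_kernel T" "w \<in> mat_kernel T" for v w
    using that T(1) by (auto simp: mat_kernel_def mult_add_distrib_mat_vec[of _ d e])
  show "c \<cdot>\<^sub>v v \<in> mat_kernel T" if "v \<in> mat_kernel T" for c v
    using mat_kernel_smult[OF T(1) that] .
  show "\<sigma> g *\<^sub>v w \<in> mat_kernel T" if g: "g \<in> carrier G" and w: "w \<in> mat_kernel T" for g w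
  proof (rule mat_kernelI[OF T(1)])
    note w = mat_kernelD[OF T(1) w]
    show "\<sigma> g *\<^sub>v w \<in> carrier_vec e" using \<sigma>(2)[OF g] w by auto
    have "T *\<^sub>v (\<sigma> g *\<^sub>v w) = (\<rho> g * T) *\<^sub>v w"
      using T \<sigma>(2)[OF g] g w by (simp add: assoc_mult_mat_vec[of _ d e _ e])
    also have "\<dots> = \<rho> g *\<^sub>v (T *\<^sub>v w)" using T(1) \<rho>[OF g] w by (intro assoc_mult_mat_vec) auto
    also have "\<dots> = 0\<^sub>v d" using \<rho>[OF g] w by auto
    finally show "T *\<^sub>v (\<sigma> g *\<^sub>v w) = 0\<^sub>v d" .
  qed
qed

lemma image_of_intertwiner:
  fixes T :: "complex mat"
  assumes "group G" "irreducible_rep G d \<rho>"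
    and \<sigma>: "\<And>g. g \<in> carrier G \<Longrightarrow> \<sigma> g \<in> carrier_mat e e"
    and T: "T \<in> carrier_mat d e" "\<And>g. g \<in> carrier G \<Longrightarrow> \<rho> g * T = T * \<sigma> g"
  shows "(*\<^sub>v) T ` carrier_vec e = {0\<^sub>v d} \<or> (*\<^sub>v) T ` carrier_vec e = carrier_vec d"
proof (rule irreducible_rep_invariant[OF assms(2)])
  note \<rho> = irreducible_repD[OF assms(1,2)]
  show "(*\<^sub>v) T ` carrier_vec e \<subseteq> carrier_vec d" using T(1) by auto
  show "0\<^sub>v d \<in> (*\<^sub>v) T ` carrier_vec e"
    using T(1) by (intro image_eqI[of _ _ "0\<^sub>v e"]) auto
  show "v + w \<in> (*\<^sub>v) T ` carrier_vec e"
    if vw: "v \<in> (*\<^sub>v) T ` carrier_vec e" "w \<in> (*\<^sub>v) T ` carrier_vec e" for v w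
  proof -
    obtain x y where "v = T *\<^sub>v x" "w = T *\<^sub>v y" "x \<in> carrier_vec e" "y \<in> carrier_vec e" using vw by auto
    then show ?thesis
      using T(1) by (intro image_eqI[of _ _ "x + y"]) (auto simp: mult_add_distrib_mat_vec[of _ d e])
  qed
  show "c \<cdot>\<^sub>v v \<in> (*\<^sub>v) T ` carrier_vec e" if v: "v \<in> (*\<^sub>v) T ` carrier_vec e" for c v
  proof -
    obtain x where "v = T *\<^sub>v x" "x \<in> carrier_vec e" using v by auto
    then show ?thesis
      using T(1) by (intro image_eqI[of _ _ "c \<cdot>\<^sub>v x"]) (auto simp: mult_mat_vec[of _ d e])
  qed
  show "\<rho> g *\<^sub>v w \<in> (*\<^sub>v) T ` carrier_vec e" if g: "g \<in> carrier G" and w: "w \<in> (*\<^sub>v) T ` carrier_vec e" for g w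
  proof -
    obtain x where x: "w = T *\<^sub>v x" "x \<in> carrier_vec e" using w by auto
    have "\<rho> g *\<^sub>v w = (\<rho> g * T) *\<^sub>v x"
      using x T(1) \<rho>(2)[OF g] by (simp add: assoc_mult_mat_vec[of _ d d _ e])
    also have "\<dots> = T *\<^sub>v (\<sigma> g *\<^sub>v x)"
      using x T g \<sigma>[OF g] by (simp add: assoc_mult_mat_vec[of _ d e _ e])
    finally show ?thesis using x \<sigma>[OF g] by auto
  qed
qed

lemma mat_eq_zeroI:
  fixes T :: "complex mat"
  assumes T: "T \<in> carrier_mat d e" and z: "\<And>v. v \<in> carrier_vec e \<Longrightarrow> T *\<^sub>v v = 0\<^sub>v d"
  shows "T = 0\<^sub>m d e"
proof (rule eq_matI)
  fix i j assume ij: "i < dim_row (0\<^sub>m d e :: complex mat)" "j < dim_col (0\<^sub>m d e :: complex mat)"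
  then have "T *\<^sub>v unit_vec e j = col T j" using T by (intro eq_vecI) (auto simp: scalar_prod_right_unit)
  moreover have "T *\<^sub>v unit_vec e j = 0\<^sub>v d" by (intro z) simp
  ultimately have "col T j $ i = 0\<^sub>v d $ i" by simp
  then have "col T j $ i = 0" using ij by simp
  then show "T $$ (i, j) = 0\<^sub>m d e $$ (i, j)" using T ij by simp
qed (use T in auto)

lemma mat_eq_if_minus_eq_zero:
  fixes A B :: "complex mat"
  assumes A: "A \<in> carrier_mat d e" and B: "B \<in> carrier_mat d e" and z: "A - B = 0\<^sub>m d e"
  shows "A = B"
proof (rule eq_matI)
  fix i j assume ij: "i < dim_row B" "j < dim_col B"
  have "(A - B) $$ (i, j) = 0\<^sub>m d e $$ (i, j)" using z by simp
  then show "A $$ (i, j) = B $$ (i, j)" using ij A B by simp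
qed (use A B in auto)

lemma mat_trace_comm:
  assumes A: "A \<in> carrier_mat d e" and B: "B \<in> carrier_mat e d"
  shows "mat_trace (A * B) = mat_trace (B * A)"
proof -
  have "mat_trace (A * B) = (\<Sum>i<d. \<Sum>k<e. A $$ (i, k) * B $$ (k, i))"
    using A B by (auto simp: mat_trace_def scalar_prod_def lessThan_atLeast0 intro!: sum.cong)
  also have "\<dots> = (\<Sum>k<e. \<Sum>i<d. B $$ (k, i) * A $$ (i, k))"
    by (subst sum.swap) (simp add: mult.commute)
  also have "\<dots> = mat_trace (B * A)"
    using A B by (auto simp: mat_trace_def scalar_prod_def lessThan_atLeast0 intro!: sum.cong)
  finally show ?thesis .
qed

text \<open>If \<open>T\<close> were not zero, its kernel would be trivial and its image everything, so \<open>T\<close> would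
  have a two-sided inverse \<open>S\<close>; then \<open>tr (\<rho> g) = tr (T (\<sigma> g) S) = tr (\<sigma> g)\<close>. Asking for different
  traces instead of inequivalent representations is what is needed to compare characters.\<close>

lemma schur_different_trace:
  assumes G: "group G" and irr: "irreducible_rep G d \<rho>" "irreducible_rep G e \<sigma>"
    and g: "g \<in> carrier G" "mat_trace (\<rho> g) \<noteq> mat_trace (\<sigma> g)"
    and T: "T \<in> carrier_mat d e" "\<And>g. g \<in> carrier G \<Longrightarrow> \<rho> g * T = T * \<sigma> g"
  shows "T = 0\<^sub>m d e"
proof (rule ccontr)
  assume nz: "T \<noteq> 0\<^sub>m d e"
  note \<rho> = irreducible_repD[OF G irr(1)] and \<sigma> = irreducible_repD[OF G irr(2)]
  obtain v where v: "v \<in> carrier_vec e" "T *\<^sub>v v \<noteq> 0\<^sub>v d" using mat_eq_zeroI[OF T(1)] nz by blast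
  have ker: "mat_kernel T = {0\<^sub>v e}"
    using kernel_of_intertwiner[OF G irr(2) \<rho>(2) T] v mat_kernelD[OF T(1), of v] by blast
  have "(*\<^sub>v) T ` carrier_vec e = carrier_vec d"
    using image_of_intertwiner[OF G irr(1) \<sigma>(2) T] v by blast
  then have "\<forall>i<d. \<exists>x\<in>carrier_vec e. T *\<^sub>v x = unit_vec d i"
    by (metis imageE unit_vec_carrier)
  then obtain x where x: "\<And>i. i < d \<Longrightarrow> x i \<in> carrier_vec e \<and> T *\<^sub>v x i = unit_vec d i" by metis
  \<comment> \<open>The columns of \<open>S\<close> are preimages of the unit vectors, so \<open>S\<close> is a right inverse; the
    injectivity of \<open>T\<close> makes it a left inverse.\<close>
  define S where "S = mat e d (\<lambda>(i, j). x j $ i)"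
  have S: "S \<in> carrier_mat e d" unfolding S_def by simp
  have TS: "T * S = 1\<^sub>m d"
  proof (rule eq_matI)
    fix i j assume ij: "i < dim_row (1\<^sub>m d :: complex mat)" "j < dim_col (1\<^sub>m d :: complex mat)"
    have "col S j = x j" using ij x[of j] by (auto simp: S_def)
    moreover have "(T * S) $$ (i, j) = (T *\<^sub>v col S j) $ i"
      using ij T(1) S by simp
    ultimately show "(T * S) $$ (i, j) = 1\<^sub>m d $$ (i, j)"
      using x[of j] ij by (auto simp: unit_vec_def)
  qed (use T(1) S in auto)
  have diff: "S * T - 1\<^sub>m e = 0\<^sub>m e e"
  proof (rule mat_eq_zeroI)
    fix w :: "complex vec" assume w: "w \<in> carrier_vec e"
    let ?u = "(S * T - 1\<^sub>m e) *\<^sub>v w"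
    have "T *\<^sub>v ?u = (T * (S * T - 1\<^sub>m e)) *\<^sub>v w"
      using T(1) S w by (intro assoc_mult_mat_vec[symmetric]) auto
    also have "T * (S * T - 1\<^sub>m e) = T * (S * T) - T * 1\<^sub>m e"
      using T(1) S by (intro mult_minus_distrib_mat) auto
    also have "T * (S * T) = T" using T(1) S TS by (simp add: assoc_mult_mat[of _ d e _ d _ e, symmetric])
    also have "T - T * 1\<^sub>m e = 0\<^sub>m d e" using T(1) by auto
    also have "0\<^sub>m d e *\<^sub>v w = 0\<^sub>v d" using w by auto
    finally have "?u \<in> mat_kernel T"
      using T(1) mult_mat_vec_carrier[OF _ w, of "S * T - 1\<^sub>m e" e] minus_carrier_mat[of "1\<^sub>m e" e e "S * T"]
      by (intro mat_kernelI) auto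
    then show "?u = 0\<^sub>v e" using ker by blast
  qed (use T(1) S in auto)
  have ST: "S * T = 1\<^sub>m e"
    by (rule mat_eq_if_minus_eq_zero[OF _ _ diff]) (use T(1) S in auto)
  have "mat_trace (\<rho> g) = mat_trace (\<rho> g * (T * S))" using \<rho>(2)[OF g(1)] TS by simp
  also have "\<rho> g * (T * S) = \<rho> g * T * S"
    using T(1) S \<rho>(2)[OF g(1)] by (intro assoc_mult_mat[symmetric]) auto
  also have "\<dots> = T * \<sigma> g * S" by (simp only: T(2)[OF g(1)])
  also have "\<dots> = T * (\<sigma> g * S)"
    using T(1) S \<sigma>(2)[OF g(1)] by (intro assoc_mult_mat) auto
  also have "mat_trace \<dots> = mat_trace ((\<sigma> g * S) * T)"
    using T(1) S \<sigma>(2)[OF g(1)] by (intro mat_trace_comm[of _ d e]) auto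
  also have "(\<sigma> g * S) * T = \<sigma> g * (S * T)"
    using T(1) S \<sigma>(2)[OF g(1)] by (intro assoc_mult_mat) auto
  also have "\<dots> = \<sigma> g" using \<sigma>(2)[OF g(1)] ST by simp
  finally show False using g(2) by simp
qed

text \<open>An eigenvalue \<open>c\<close> exists over the complex numbers, and the kernel of \<open>T - c\<close> is invariant
  and not zero, hence everything.\<close>

lemma schur_scalar:
  assumes G: "group G" and irr: "irreducible_rep G d \<rho>"
    and T: "T \<in> carrier_mat d d" "\<And>g. g \<in> carrier G \<Longrightarrow> \<rho> g * T = T * \<rho> g"
  shows "\<exists>c. T = c \<cdot>\<^sub>m 1\<^sub>m d"
proof -
  note \<rho> = irreducible_repD[OF G irr]
  obtain c where "eigenvalue T c" using spectrum_non_empty[OF T(1)] \<rho>(1) by (auto simp: spectrum_def)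
  then obtain v where v: "v \<in> carrier_vec d" "v \<noteq> 0\<^sub>v d" "T *\<^sub>v v = c \<cdot>\<^sub>v v"
    using T(1) by (auto simp: eigenvalue_def eigenvector_def)
  let ?U = "T - c \<cdot>\<^sub>m 1\<^sub>m d"
  have U: "?U \<in> carrier_mat d d" using T(1) by auto
  have smult: "(c \<cdot>\<^sub>m 1\<^sub>m d) *\<^sub>v w = c \<cdot>\<^sub>v w" if "w \<in> carrier_vec d" for w :: "complex vec"
  proof (rule eq_vecI)
    fix i assume "i < dim_vec (c \<cdot>\<^sub>v w)"
    then have i: "i < d" using that by simp
    have "row (c \<cdot>\<^sub>m 1\<^sub>m d) i = c \<cdot>\<^sub>v unit_vec d i" using i by (intro eq_vecI) (auto simp: unit_vec_def)
    then show "((c \<cdot>\<^sub>m 1\<^sub>m d) *\<^sub>v w) $ i = (c \<cdot>\<^sub>v w) $ i"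
      using i that by (simp add: smult_scalar_prod_distrib[of _ d] scalar_prod_left_unit)
  qed (use that in auto)
  have "?U *\<^sub>v v = 0\<^sub>v d"
    using T(1) v smult by (subst minus_mult_distrib_mat_vec[of _ d d]) auto
  then have ne: "mat_kernel ?U \<noteq> {0\<^sub>v d}" using v U mat_kernelI[OF U] by blast
  have comm: "\<rho> g * ?U = ?U * \<rho> g" if g: "g \<in> carrier G" for g
  proof -
    have "\<rho> g * ?U = \<rho> g * T - \<rho> g * (c \<cdot>\<^sub>m 1\<^sub>m d)"
      using \<rho>(2)[OF g] T(1) by (intro mult_minus_distrib_mat) auto
    also have "\<dots> = T * \<rho> g - (c \<cdot>\<^sub>m 1\<^sub>m d) * \<rho> g"
      using \<rho>(2)[OF g] T g by (simp add: mult_smult_distrib[of _ d d _ d] mult_smult_assoc_mat[of _ d d _ d])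
    also have "\<dots> = ?U * \<rho> g"
      using \<rho>(2)[OF g] T(1) by (intro minus_mult_distrib_mat[symmetric]) auto
    finally show ?thesis .
  qed
  have "mat_kernel ?U = carrier_vec d"
    using kernel_of_intertwiner[OF G irr \<rho>(2) U comm] ne by simp
  then have diff: "?U = 0\<^sub>m d d" using mat_kernelD[OF U] by (intro mat_eq_zeroI[OF U]) blast
  have "T = c \<cdot>\<^sub>m 1\<^sub>m d"
    by (rule mat_eq_if_minus_eq_zero[OF T(1) _ diff]) simp
  then show ?thesis by blast
qed

text \<open>The average (up to the factor \<open>|G|\<close>) of the matrix unit \<open>E\<^sub>k\<^sub>l\<close> over the group, that is,
  \<open>\<Sum>g. \<rho>(g) E\<^sub>k\<^sub>l \<sigma>(g\<^sup>-\<^sup>1)\<close>. Its entries are exactly the sums that the orthogonality relations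
  evaluate.\<close>

definition averaged_unit ::
  "('a, 'b) monoid_scheme \<Rightarrow> nat \<Rightarrow> ('a \<Rightarrow> complex mat) \<Rightarrow> nat \<Rightarrow> ('a \<Rightarrow> complex mat) \<Rightarrow> nat \<Rightarrow> nat \<Rightarrow> complex mat"
where "averaged_unit G d \<rho> e \<sigma> k l =
  mat d e (\<lambda>(i, j). \<Sum>g\<in>carrier G. \<rho> g $$ (i, k) * \<sigma> (inv\<^bsub>G\<^esub> g) $$ (l, j))"

lemma averaged_unit_intertwines:
  assumes G: "group G" and irr: "irreducible_rep G d \<rho>" "irreducible_rep G e \<sigma>"
    and kl: "k < d" "l < e" and h: "h \<in> carrier G"
  shows "\<rho> h * averaged_unit G d \<rho> e \<sigma> k l = averaged_unit G d \<rho> e \<sigma> k l * \<sigma> h"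
proof (rule eq_matI)
  note \<rho> = irreducible_repD[OF G irr(1)] and \<sigma> = irreducible_repD[OF G irr(2)]
  interpret group G by (rule G)
  let ?T = "averaged_unit G d \<rho> e \<sigma> k l"
  have dims: "dim_row (\<rho> h) = d" "dim_col (\<rho> h) = d" "dim_row (\<sigma> h) = e" "dim_col (\<sigma> h) = e"
    using \<rho>(2)[OF h] \<sigma>(2)[OF h] by auto
  fix i j assume "i < dim_row (?T * \<sigma> h)" "j < dim_col (?T * \<sigma> h)"
  then have ij: "i < d" "j < e" using dims by (auto simp: averaged_unit_def)
  have ent\<rho>: "\<rho> (h \<otimes>\<^bsub>G\<^esub> g) $$ (i, k) = (\<Sum>a<d. \<rho> h $$ (i, a) * \<rho> g $$ (a, k))" if "g \<in> carrier G" for g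
    using \<rho>(2)[OF that] \<rho>(2)[OF h] ij kl \<rho>(3)[OF h that]
    by (auto simp: scalar_prod_def lessThan_atLeast0 intro!: sum.cong)
  have ent\<sigma>: "\<sigma> (g \<otimes>\<^bsub>G\<^esub> h) $$ (l, j) = (\<Sum>b<e. \<sigma> g $$ (l, b) * \<sigma> h $$ (b, j))" if "g \<in> carrier G" for g
    using \<sigma>(2)[OF that] \<sigma>(2)[OF h] ij kl \<sigma>(3)[OF that h]
    by (auto simp: scalar_prod_def lessThan_atLeast0 intro!: sum.cong)
  have "(\<rho> h * ?T) $$ (i, j) = (\<Sum>a<d. \<rho> h $$ (i, a) * (\<Sum>g\<in>carrier G. \<rho> g $$ (a, k) * \<sigma> (inv\<^bsub>G\<^esub> g) $$ (l, j)))"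
    using ij dims by (auto simp: averaged_unit_def scalar_prod_def lessThan_atLeast0 intro!: sum.cong)
  also have "\<dots> = (\<Sum>g\<in>carrier G. \<rho> (h \<otimes>\<^bsub>G\<^esub> g) $$ (i, k) * \<sigma> (inv\<^bsub>G\<^esub> g) $$ (l, j))"
    unfolding sum_distrib_left by (subst sum.swap) (auto simp: ent\<rho> sum_distrib_right mult.assoc intro!: sum.cong)
  also have "\<dots> = (\<Sum>g\<in>carrier G. \<rho> g $$ (i, k) * \<sigma> (inv\<^bsub>G\<^esub> g \<otimes>\<^bsub>G\<^esub> h) $$ (l, j))"
    by (rule sum.reindex_bij_witness[where i = "\<lambda>g. inv\<^bsub>G\<^esub> h \<otimes>\<^bsub>G\<^esub> g" and j = "\<lambda>g. h \<otimes>\<^bsub>G\<^esub> g"])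
      (use h in \<open>auto simp: m_assoc[symmetric] inv_mult_group\<close>, simp_all add: m_assoc)
  also have "\<dots> = (\<Sum>b<e. (\<Sum>g\<in>carrier G. \<rho> g $$ (i, k) * \<sigma> (inv\<^bsub>G\<^esub> g) $$ (l, b)) * \<sigma> h $$ (b, j))"
    unfolding sum_distrib_right by (subst sum.swap) (auto simp: ent\<sigma> sum_distrib_left mult.assoc intro!: sum.cong)
  also have "\<dots> = (?T * \<sigma> h) $$ (i, j)"
    using ij dims by (auto simp: averaged_unit_def scalar_prod_def lessThan_atLeast0 intro!: sum.cong)
  finally show "(\<rho> h * ?T) $$ (i, j) = (?T * \<sigma> h) $$ (i, j)" .
qed (use irreducible_repD(2)[OF G irr(1) h] irreducible_repD(2)[OF G irr(2) h] in \<open>auto simp: averaged_unit_def\<close>)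

lemma schur_orthogonality_different:
  assumes G: "group G" and irr: "irreducible_rep G d \<rho>" "irreducible_rep G e \<sigma>"
    and g: "h \<in> carrier G" "mat_trace (\<rho> h) \<noteq> mat_trace (\<sigma> h)"
    and "i < d" "k < d" "l < e" "j < e"
  shows "(\<Sum>g\<in>carrier G. \<rho> g $$ (i, k) * \<sigma> (inv\<^bsub>G\<^esub> g) $$ (l, j)) = 0"
proof -
  let ?T = "averaged_unit G d \<rho> e \<sigma> k l"
  have "?T = 0\<^sub>m d e"
    by (rule schur_different_trace[OF G irr g])
      (use assms averaged_unit_intertwines[OF G irr] in \<open>auto simp: averaged_unit_def\<close>)
  from arg_cong[OF this, of "\<lambda>A. A $$ (i, j)"] show ?thesis using assms by (simp add: averaged_unit_def)
qed

text \<open>The averaged matrix unit is a scalar matrix; the scalar is found from its trace, which is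
  \<open>|G|\<close> times the trace of the matrix unit.\<close>

lemma schur_orthogonality_same:
  assumes G: "group G" "finite (carrier G)" and irr: "irreducible_rep G d \<rho>"
    and ik: "i < d" "k < d" "l < d" "j < d"
  shows "(\<Sum>g\<in>carrier G. \<rho> g $$ (i, k) * \<rho> (inv\<^bsub>G\<^esub> g) $$ (l, j))
    = of_bool (i = j \<and> l = k) * (of_nat (Coset.order G) / of_nat d)"
proof -
  note \<rho> = irreducible_repD[OF G(1) irr]
  interpret group G by (rule G)
  let ?T = "averaged_unit G d \<rho> d \<rho> k l"
  have "\<exists>c. ?T = c \<cdot>\<^sub>m 1\<^sub>m d"
    by (rule schur_scalar[OF G(1) irr])
      (use ik averaged_unit_intertwines[OF G(1) irr irr] in \<open>auto simp: averaged_unit_def\<close>)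
  then obtain c where c: "?T = c \<cdot>\<^sub>m 1\<^sub>m d" by blast
  have ent: "(\<Sum>g\<in>carrier G. \<rho> g $$ (a, k) * \<rho> (inv\<^bsub>G\<^esub> g) $$ (l, b)) = c * of_bool (a = b)" if "a < d" "b < d" for a b
    using arg_cong[OF c, of "\<lambda>A. A $$ (a, b)"] that by (simp add: averaged_unit_def)
  have "of_nat d * c = (\<Sum>a<d. \<Sum>g\<in>carrier G. \<rho> g $$ (a, k) * \<rho> (inv\<^bsub>G\<^esub> g) $$ (l, a))"
    by (simp add: ent)
  also have "\<dots> = (\<Sum>g\<in>carrier G. \<rho> (inv\<^bsub>G\<^esub> g \<otimes>\<^bsub>G\<^esub> g) $$ (l, k))"
  proof (subst sum.swap, rule sum.cong[OF refl])
    fix g assume g: "g \<in> carrier G"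
    show "(\<Sum>a<d. \<rho> g $$ (a, k) * \<rho> (inv\<^bsub>G\<^esub> g) $$ (l, a)) = \<rho> (inv\<^bsub>G\<^esub> g \<otimes>\<^bsub>G\<^esub> g) $$ (l, k)"
      using g ik \<rho>(2)[OF g] \<rho>(2)[of "inv\<^bsub>G\<^esub> g"] \<rho>(3)[of "inv\<^bsub>G\<^esub> g" g]
      by (auto simp: scalar_prod_def lessThan_atLeast0 mult.commute simp del: l_inv intro!: sum.cong)
  qed
  also have "\<dots> = of_nat (Coset.order G) * of_bool (l = k)"
    using ik \<rho>(4) by (simp add: Coset.order_def)
  finally have "c = of_bool (l = k) * (of_nat (Coset.order G) / of_nat d)"
    using \<rho>(1) by (simp add: field_simps)
  then show ?thesis using ent[of i j] ik by auto
qed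

text \<open>The representation \<open>\<rho> x\<close> has \<open>(d x)\<^sup>2\<close> matrix coefficients. By the orthogonality relations the
  coefficients at the inverse element, scaled by \<open>d x / |G|\<close>, form a dual family, so there are at
  most as many coefficients as elements of \<open>G\<close>.\<close>

lemma sum_square_degrees_le_finite:
  fixes d :: "'i \<Rightarrow> nat"
  assumes G: "group G" "finite (carrier G)" and "finite X"
    and irr: "\<And>x. x \<in> X \<Longrightarrow> irreducible_rep G (d x) (\<rho> x)"
    and diff: "\<And>x y. x \<in> X \<Longrightarrow> y \<in> X \<Longrightarrow> x \<noteq> y \<Longrightarrow>
      \<exists>g\<in>carrier G. mat_trace (\<rho> x g) \<noteq> mat_trace (\<rho> y g)"
  shows "(\<Sum>x\<in>X. d x ^ 2) \<le> Coset.order G"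
proof -
  let ?I = "SIGMA x:X. {..<d x} \<times> {..<d x}"
  let ?f = "\<lambda>(x, i, k) g. \<rho> x g $$ (i, k)"
  let ?h = "\<lambda>(x, j, l) g. \<rho> x (inv\<^bsub>G\<^esub> g) $$ (l, j) * (of_nat (d x) / of_nat (Coset.order G))"
  have n: "Coset.order G > 0" using G group.is_monoid monoid.order_gt_0_iff_finite by blast
  have "card ?I \<le> card (carrier G)"
  proof (rule card_le_biorthogonal[of _ _ ?f ?h])
    fix a b assume "a \<in> ?I" "b \<in> ?I"
    then obtain x i k y j l where ab: "a = (x, i, k)" "b = (y, j, l)"
      and mem: "x \<in> X" "i < d x" "k < d x" "y \<in> X" "j < d y" "l < d y" by auto
    have "(\<Sum>g\<in>carrier G. ?f a g * ?h b g) =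
      (\<Sum>g\<in>carrier G. \<rho> x g $$ (i, k) * \<rho> y (inv\<^bsub>G\<^esub> g) $$ (l, j)) * (of_nat (d y) / of_nat (Coset.order G))"
      by (simp add: ab sum_distrib_right sum_divide_distrib mult.assoc)
    also have "\<dots> = of_bool (a = b)"
    proof (cases "x = y")
      case False
      then obtain g where "g \<in> carrier G" "mat_trace (\<rho> x g) \<noteq> mat_trace (\<rho> y g)" using diff mem by blast
      from schur_orthogonality_different[OF G(1) irr irr this] show ?thesis using mem False by (simp add: ab)
    next
      case True
      then show ?thesis
        using schur_orthogonality_same[OF G irr, of x i k l j] mem irreducible_repD(1)[OF G(1) irr, of x] n
        by (auto simp: ab)
    qed
    finally show "(\<Sum>g\<in>carrier G. ?f a g * ?h b g) = of_bool (a = b)" .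
  qed (use assms in auto)
  moreover have "card ?I = (\<Sum>x\<in>X. d x ^ 2)"
    using \<open>finite X\<close> by (subst card_SigmaI) (auto simp: card_cartesian_product power2_eq_square)
  ultimately show ?thesis by (simp add: Coset.order_def)
qed

section \<open>Linear characters and the dual group\<close>

lemma card_image_eq_if_same_fibres:
  assumes "\<And>x y. x \<in> A \<Longrightarrow> y \<in> A \<Longrightarrow> f x = f y \<longleftrightarrow> g x = g y"
  shows "card (f ` A) = card (g ` A)"
proof -
  let ?P = "(\<lambda>x. (f x, g x)) ` A"
  have "card (fst ` ?P) = card ?P" "card (snd ` ?P) = card ?P"
    using assms by (auto intro!: card_image inj_onI)
  then show ?thesis by (simp add: image_image)
qed

text \<open>The homomorphism theorem as a count, for any \<open>f\<close> whose fibres are the cosets of \<open>K\<close>. It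
  serves both for linear characters and for the evaluation map into the double dual.\<close>

lemma (in group) card_rcosets_eq_card_image:
  assumes K: "subgroup K G"
    and f: "\<And>x y. x \<in> carrier G \<Longrightarrow> y \<in> carrier G \<Longrightarrow> f x = f y \<longleftrightarrow> x \<otimes> inv y \<in> K"
  shows "card (rcosets K) = card (f ` carrier G)"
proof -
  have "rcosets K = (\<lambda>x. K #> x) ` carrier G" by (auto simp: RCOSETS_def)
  moreover have "K #> x = K #> y \<longleftrightarrow> f x = f y" if xy: "x \<in> carrier G" "y \<in> carrier G" for x y
  proof
    assume "K #> x = K #> y"
    then have "x \<in> K #> y" using rcos_self[OF xy(1) K] by simp
    then show "f x = f y" using f[OF xy] subgroup.rcos_module_imp[OF K is_group xy(2)] by simp
  next
    assume "f x = f y"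
    then have "x \<in> K #> y" using f[OF xy] subgroup.rcos_module_rev[OF K is_group xy(2,1)] by simp
    then show "K #> x = K #> y" using repr_independence[OF _ xy(2) K] by simp
  qed
  ultimately show ?thesis using card_image_eq_if_same_fibres[of "carrier G" "\<lambda>x. K #> x" f] by simp
qed

text \<open>Like the elements of \<open>Irr G\<close>, linear characters are extensional, so that HOL equality is
  equality on the group.\<close>

definition linear_chars :: "('a, 'b) monoid_scheme \<Rightarrow> ('a \<Rightarrow> complex) set" where
  "linear_chars G = {\<chi> \<in> extensional (carrier G). \<chi> \<one>\<^bsub>G\<^esub> = 1 \<and>
     (\<forall>x\<in>carrier G. \<forall>y\<in>carrier G. \<chi> (x \<otimes>\<^bsub>G\<^esub> y) = \<chi> x * \<chi> y)}"

lemma linear_charsD: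
  assumes "\<chi> \<in> linear_chars G"
  shows "\<chi> \<in> extensional (carrier G)" "\<chi> \<one>\<^bsub>G\<^esub> = 1"
    and "x \<in> carrier G \<Longrightarrow> y \<in> carrier G \<Longrightarrow> \<chi> (x \<otimes>\<^bsub>G\<^esub> y) = \<chi> x * \<chi> y"
  using assms by (auto simp: linear_chars_def)

lemma linear_char_inv:
  assumes "group G" "\<chi> \<in> linear_chars G" "x \<in> carrier G"
  shows "\<chi> x * \<chi> (inv\<^bsub>G\<^esub> x) = 1" "\<chi> x \<noteq> 0"
proof -
  interpret group G by fact
  show "\<chi> x * \<chi> (inv\<^bsub>G\<^esub> x) = 1"
    using linear_charsD(3)[OF assms(2,3), of "inv\<^bsub>G\<^esub> x"] linear_charsD(2)[OF assms(2)] assms(3) by simp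
  then show "\<chi> x \<noteq> 0" by auto
qed

lemma linear_char_eq_iff:
  assumes "group G" "\<chi> \<in> linear_chars G" "x \<in> carrier G" "y \<in> carrier G"
  shows "\<chi> x = \<chi> y \<longleftrightarrow> \<chi> (x \<otimes>\<^bsub>G\<^esub> inv\<^bsub>G\<^esub> y) = 1"
proof -
  interpret group G by fact
  have "\<chi> (x \<otimes>\<^bsub>G\<^esub> inv\<^bsub>G\<^esub> y) * \<chi> y = \<chi> x * (\<chi> y * \<chi> (inv\<^bsub>G\<^esub> y))"
    using linear_charsD(3)[OF assms(2,3), of "inv\<^bsub>G\<^esub> y"] assms(4) by (simp add: mult_ac)
  then have "\<chi> (x \<otimes>\<^bsub>G\<^esub> inv\<^bsub>G\<^esub> y) * \<chi> y = \<chi> x"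
    using linear_char_inv(1)[OF assms(1,2,4)] by simp
  then show ?thesis using linear_char_inv(2)[OF assms(1,2,4)] by auto
qed

lemma subgroup_char_ker:
  assumes "group G" "\<chi> \<in> linear_chars G"
  shows "subgroup (char_ker G \<chi>) G"
proof -
  interpret group G by fact
  show ?thesis
  proof (rule subgroupI)
    fix a assume a: "a \<in> char_ker G \<chi>"
    then show "inv\<^bsub>G\<^esub> a \<in> char_ker G \<chi>"
      using linear_char_inv(1)[OF assms, of a] linear_charsD(2)[OF assms(2)] by (auto simp: char_ker_def)
    fix b assume "b \<in> char_ker G \<chi>"
    then show "a \<otimes>\<^bsub>G\<^esub> b \<in> char_ker G \<chi>"
      using a linear_charsD(2,3)[OF assms(2)] by (auto simp: char_ker_def)
  qed (auto simp: char_ker_def)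
qed

lemma cod_linear_char:
  assumes "group G" "\<chi> \<in> linear_chars G"
  shows "cod G \<chi> = card (\<chi> ` carrier G)"
proof -
  interpret group G by fact
  have "card (rcosets\<^bsub>G\<^esub> (char_ker G \<chi>)) = card (\<chi> ` carrier G)"
    using linear_char_eq_iff[OF assms] linear_charsD(2)[OF assms(2)]
    by (intro card_rcosets_eq_card_image subgroup_char_ker assms) (auto simp: char_ker_def)
  then show ?thesis using linear_charsD(2)[OF assms(2)] by (simp add: cod_def)
qed

lemma irreducible_rep_linear_char:
  assumes G: "group G" and \<chi>: "\<chi> \<in> linear_chars G"
  shows "irreducible_rep G 1 (\<lambda>g. mat 1 1 (\<lambda>_. \<chi> g))"
proof -
  interpret group G by fact
  let ?\<rho> = "\<lambda>g. mat 1 1 (\<lambda>_. \<chi> g)"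
  have mult: "mat 1 1 (\<lambda>_. a) * mat 1 1 (\<lambda>_. b) = mat 1 1 (\<lambda>_. a * b)" for a b :: complex
    by (rule eq_matI) (auto simp: scalar_prod_def)
  have one: "mat 1 1 (\<lambda>_. 1) = (1\<^sub>m 1 :: complex mat)" by (rule eq_matI) auto
  have "?\<rho> \<in> hom G (GL 1)"
  proof (rule homI)
    fix x assume x: "x \<in> carrier G"
    have "?\<rho> x * ?\<rho> (inv\<^bsub>G\<^esub> x) = 1\<^sub>m 1" "?\<rho> (inv\<^bsub>G\<^esub> x) * ?\<rho> x = 1\<^sub>m 1"
      unfolding mult one[symmetric] using linear_char_inv(1)[OF G \<chi> x] by (simp_all add: mult.commute)
    then show "?\<rho> x \<in> carrier (GL 1)"
      unfolding GL_def units_of_def Units_def by (auto simp: ring_mat_simps intro!: exI bexI[of _ "?\<rho> (inv\<^bsub>G\<^esub> x)"])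
    fix y assume y: "y \<in> carrier G"
    show "?\<rho> (x \<otimes>\<^bsub>G\<^esub> y) = ?\<rho> x \<otimes>\<^bsub>GL 1\<^esub> ?\<rho> y"
      using linear_charsD(3)[OF \<chi> x y] mult by (simp add: GL_def units_of_def ring_mat_simps)
  qed
  moreover have "W = {0\<^sub>v 1} \<or> W = carrier_vec 1"
    if "VectorSpace.subspace class_ring W (module_vec TYPE(complex) 1)" for W
  proof -
    have sub: "submodule class_ring W (module_vec TYPE(complex) 1)" using that by (rule subspace.submod)
    have W: "W \<subseteq> carrier_vec 1" "0\<^sub>v 1 \<in> W"
      using submodule.subset[OF sub] submodule.zero_closed[OF sub] by (simp_all add: module_vec_simps)
    have smult: "c \<cdot>\<^sub>v v \<in> W" if "v \<in> W" for c v
      using submodule.smult_closed[OF sub, of c v] that by (simp add: module_vec_simps)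
    show ?thesis
    proof (cases "W = {0\<^sub>v 1}")
      case False
      then obtain w where w: "w \<in> W" "w \<noteq> 0\<^sub>v 1" using W by blast
      have w1: "w \<in> carrier_vec 1" using w W by blast
      have "w $ 0 \<noteq> 0"
      proof
        assume "w $ 0 = 0"
        then have "w = 0\<^sub>v 1" using w1 by (intro eq_vecI) auto
        then show False using w by simp
      qed
      then have "v = (v $ 0 / w $ 0) \<cdot>\<^sub>v w" if "v \<in> carrier_vec 1" for v
        using that w1 by (intro eq_vecI) auto
      then have "carrier_vec 1 \<subseteq> W" using smult[OF w(1)] by (metis subsetI)
      then show ?thesis using W by blast
    qed simp
  qed
  ultimately show ?thesis unfolding irreducible_rep_def by blast
qed

lemma linear_chars_subset_Irr:
  assumes G: "group G"
  shows "linear_chars G \<subseteq> Irr G"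
proof
  fix \<chi> assume \<chi>: "\<chi> \<in> linear_chars G"
  have "\<chi> = restrict (\<lambda>g. mat_trace (mat 1 1 (\<lambda>_. \<chi> g))) (carrier G)"
    using linear_charsD(1)[OF \<chi>] by (auto simp: mat_trace_def extensional_def restrict_def fun_eq_iff)
  then show "\<chi> \<in> Irr G"
    unfolding Irr_def mem_Collect_eq
    using irreducible_rep_linear_char[OF G \<chi>]
    by (intro exI[of _ 1] exI[of _ "\<lambda>g. mat 1 1 (\<lambda>_. \<chi> g)"] conjI)
qed

lemma Irr_degree:
  assumes G: "group G" and "\<chi> \<in> Irr G"
  shows "\<exists>d>0. \<chi> \<one>\<^bsub>G\<^esub> = of_nat d \<and> (d = 1 \<longrightarrow> \<chi> \<in> linear_chars G)"
proof -
  interpret group G by fact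
  obtain d \<rho> where irr: "irreducible_rep G d \<rho>" and \<chi>: "\<chi> = restrict (\<lambda>g. mat_trace (\<rho> g)) (carrier G)"
    using assms(2) by (auto simp: Irr_def)
  note \<rho> = irreducible_repD[OF G irr]
  have "\<chi> \<one>\<^bsub>G\<^esub> = of_nat d" using degree_eq_trace_one[OF G irr] \<chi> by simp
  moreover have "\<chi> \<in> linear_chars G" if "d = 1"
  proof -
    have tr: "mat_trace (\<rho> g) = \<rho> g $$ (0, 0)" if "g \<in> carrier G" for g
      using \<rho>(2)[OF that] \<open>d = 1\<close> by (simp add: mat_trace_def)
    have mult: "mat_trace (\<rho> (x \<otimes>\<^bsub>G\<^esub> y)) = mat_trace (\<rho> x) * mat_trace (\<rho> y)"
      if xy: "x \<in> carrier G" "y \<in> carrier G" for x y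
    proof -
      have "(\<rho> x * \<rho> y) $$ (0, 0) = \<rho> x $$ (0, 0) * \<rho> y $$ (0, 0)"
        using \<rho>(2)[OF xy(1)] \<rho>(2)[OF xy(2)] \<open>d = 1\<close> by (simp add: scalar_prod_def)
      then show ?thesis using xy tr[of "x \<otimes>\<^bsub>G\<^esub> y"] by (simp add: tr \<rho>(3))
    qed
    show ?thesis using \<chi> \<open>\<chi> \<one>\<^bsub>G\<^esub> = of_nat d\<close> \<open>d = 1\<close> mult by (simp add: linear_chars_def)
  qed
  ultimately show ?thesis using \<rho>(1) by blast
qed

lemma Irr_sum_squares:
  assumes G: "group G" "finite (carrier G)"
  shows "finite (Irr G)" "(\<Sum>\<chi>\<in>Irr G. (Re (\<chi> \<one>\<^bsub>G\<^esub>))\<^sup>2) \<le> Coset.order G"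
proof -
  interpret group G by fact
  have "\<forall>\<chi>\<in>Irr G. \<exists>d \<rho>. irreducible_rep G d \<rho> \<and> \<chi> = restrict (\<lambda>g. mat_trace (\<rho> g)) (carrier G)"
    by (auto simp: Irr_def)
  then obtain D R where irr: "\<And>\<chi>. \<chi> \<in> Irr G \<Longrightarrow> irreducible_rep G (D \<chi>) (R \<chi>)"
    and trace: "\<And>\<chi>. \<chi> \<in> Irr G \<Longrightarrow> \<chi> = restrict (\<lambda>g. mat_trace (R \<chi> g)) (carrier G)"
    by metis
  have D: "Re (\<chi> \<one>\<^bsub>G\<^esub>) = D \<chi>" if "\<chi> \<in> Irr G" for \<chi>
    using degree_eq_trace_one[OF G(1) irr[OF that]] arg_cong[OF trace[OF that], of "\<lambda>f. f \<one>\<^bsub>G\<^esub>"] by simp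
  have sq: "(\<Sum>\<chi>\<in>X. D \<chi> ^ 2) \<le> Coset.order G" if X: "finite X" "X \<subseteq> Irr G" for X
  proof (rule sum_square_degrees_le_finite[OF G X(1)])
    show "irreducible_rep G (D \<chi>) (R \<chi>)" if "\<chi> \<in> X" for \<chi> using irr that X by blast
    fix \<chi> \<psi> assume "\<chi> \<in> X" "\<psi> \<in> X" "\<chi> \<noteq> \<psi>"
    then have "\<chi> \<in> Irr G" "\<psi> \<in> Irr G" using X by auto
    show "\<exists>g\<in>carrier G. mat_trace (R \<chi> g) \<noteq> mat_trace (R \<psi> g)"
    proof (rule ccontr)
      assume "\<not> ?thesis"
      then have "restrict (\<lambda>g. mat_trace (R \<chi> g)) (carrier G) = restrict (\<lambda>g. mat_trace (R \<psi> g)) (carrier G)"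
        by (intro restrict_ext) auto
      then show False using trace[OF \<open>\<chi> \<in> Irr G\<close>] trace[OF \<open>\<psi> \<in> Irr G\<close>] \<open>\<chi> \<noteq> \<psi>\<close> by simp
    qed
  qed
  have "card X \<le> Coset.order G" if X: "finite X" "X \<subseteq> Irr G" for X
  proof -
    have "card X = (\<Sum>\<chi>\<in>X. 1)" by simp
    also have "\<dots> \<le> (\<Sum>\<chi>\<in>X. D \<chi> ^ 2)"
      using irreducible_repD(1)[OF G(1) irr] X by (intro sum_mono) (auto simp: Suc_le_eq)
    finally show ?thesis using sq[OF X] by simp
  qed
  then show fin: "finite (Irr G)"
    by (intro finite_if_finite_subsets_card_bdd[of _ "Coset.order G", THEN conjunct1]) simp
  have "(\<Sum>\<chi>\<in>Irr G. (Re (\<chi> \<one>\<^bsub>G\<^esub>))\<^sup>2) = real (\<Sum>\<chi>\<in>Irr G. D \<chi> ^ 2)"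
    by (simp add: D)
  also have "\<dots> \<le> real (Coset.order G)" using sq[OF fin] by (intro of_nat_mono) simp
  finally show "(\<Sum>\<chi>\<in>Irr G. (Re (\<chi> \<one>\<^bsub>G\<^esub>))\<^sup>2) \<le> Coset.order G" .
qed

lemma card_linear_chars_le:
  assumes G: "group G" "finite (carrier G)"
  shows "finite (linear_chars G)" "card (linear_chars G) \<le> Coset.order G"
proof -
  note fin = Irr_sum_squares(1)[OF G] and sub = linear_chars_subset_Irr[OF G(1)]
  show "finite (linear_chars G)" using fin sub finite_subset by blast
  have "real (card (linear_chars G)) = (\<Sum>\<chi>\<in>linear_chars G. (Re (\<chi> \<one>\<^bsub>G\<^esub>))\<^sup>2)"
    by (simp add: linear_charsD(2))
  also have "\<dots> \<le> (\<Sum>\<chi>\<in>Irr G. (Re (\<chi> \<one>\<^bsub>G\<^esub>))\<^sup>2)" using fin sub by (intro sum_mono2) auto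
  also have "\<dots> \<le> real (Coset.order G)" by (rule Irr_sum_squares(2)[OF G])
  finally show "card (linear_chars G) \<le> Coset.order G" by simp
qed

definition dual_group :: "('a, 'b) monoid_scheme \<Rightarrow> ('a \<Rightarrow> complex) monoid" where
  "dual_group G = \<lparr>carrier = linear_chars G,
     monoid.mult = (\<lambda>\<chi> \<psi>. restrict (\<lambda>x. \<chi> x * \<psi> x) (carrier G)),
     one = restrict (\<lambda>_. 1) (carrier G)\<rparr>"

lemma dual_group_simps:
  "carrier (dual_group G) = linear_chars G"
  "\<chi> \<otimes>\<^bsub>dual_group G\<^esub> \<psi> = restrict (\<lambda>x. \<chi> x * \<psi> x) (carrier G)"
  "\<one>\<^bsub>dual_group G\<^esub> = restrict (\<lambda>_. 1) (carrier G)"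
  by (simp_all add: dual_group_def)

lemma comm_group_dual_group:
  assumes G: "group G"
  shows "comm_group (dual_group G)"
proof (rule comm_groupI)
  interpret group G by fact
  fix \<chi> assume "\<chi> \<in> carrier (dual_group G)"
  then have \<chi>: "\<chi> \<in> linear_chars G" by (simp add: dual_group_simps)
  show "\<one>\<^bsub>dual_group G\<^esub> \<otimes>\<^bsub>dual_group G\<^esub> \<chi> = \<chi>"
    using linear_charsD(1)[OF \<chi>] by (auto simp: dual_group_simps extensional_def restrict_def fun_eq_iff)
  show "\<exists>\<psi>\<in>carrier (dual_group G). \<psi> \<otimes>\<^bsub>dual_group G\<^esub> \<chi> = \<one>\<^bsub>dual_group G\<^esub>"
  proof (rule bexI)
    let ?\<psi> = "restrict (\<lambda>x. \<chi> (inv\<^bsub>G\<^esub> x)) (carrier G)"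
    show "?\<psi> \<otimes>\<^bsub>dual_group G\<^esub> \<chi> = \<one>\<^bsub>dual_group G\<^esub>"
      using linear_char_inv(1)[OF G \<chi>] by (auto simp: dual_group_simps restrict_def fun_eq_iff mult.commute)
    show "?\<psi> \<in> carrier (dual_group G)"
      using linear_charsD(2,3)[OF \<chi>] by (auto simp: dual_group_simps linear_chars_def inv_mult_group)
  qed
qed (use group.is_monoid[OF G] in \<open>auto simp: dual_group_simps linear_chars_def extensional_def restrict_def fun_eq_iff mult_ac monoid.m_closed monoid.one_closed\<close>)

lemma dual_group_pow:
  assumes "x \<in> carrier G"
  shows "(\<chi> [^]\<^bsub>dual_group G\<^esub> (k::nat)) x = \<chi> x ^ k"
  by (induction k) (use assms in \<open>auto simp: dual_group_simps nat_pow_def\<close>)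

lemma cod_linear_char_le_ord:
  assumes G: "group G" "finite (carrier G)" and \<chi>: "\<chi> \<in> linear_chars G"
  shows "cod G \<chi> \<le> group.ord (dual_group G) \<chi>"
proof -
  interpret D: comm_group "dual_group G" using G(1) by (rule comm_group_dual_group)
  have mem: "\<chi> \<in> carrier (dual_group G)" using \<chi> by (simp add: dual_group_simps)
  have pos: "D.ord \<chi> > 0"
    using D.ord_ge_1[OF _ mem] card_linear_chars_le(1)[OF G] by (simp add: dual_group_simps)
  have "(\<chi> x) ^ D.ord \<chi> = 1" if "x \<in> carrier G" for x
    using arg_cong[OF D.pow_ord_eq_1[OF mem], of "\<lambda>f. f x"] that by (simp add: dual_group_pow dual_group_simps)
  then have "\<chi> ` carrier G \<subseteq> {z. z ^ D.ord \<chi> = 1}" by auto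
  moreover have "finite {z :: complex. z ^ D.ord \<chi> = 1}" using pos by (intro finite_roots_unity) simp
  ultimately have "card (\<chi> ` carrier G) \<le> card {z :: complex. z ^ D.ord \<chi> = 1}" by (rule card_mono[rotated])
  then show ?thesis using cod_linear_char[OF G(1) \<chi>] card_roots_unity_eq[OF pos] by simp
qed

text \<open>Let \<open>E\<close> be the image of the evaluation homomorphism from \<open>G\<close> to its double dual. Its order
  divides that of \<open>G\<close>. As a set of linear characters of the dual, \<open>E\<close> has at most as many elements
  as the dual. Conversely, evaluating the elements of \<open>E\<close> at a linear character of \<open>G\<close> is a linear
  character of \<open>E\<close>, and different characters of \<open>G\<close> give different ones; so there are at most \<open>|E|\<close>
  of them.\<close>

lemma card_linear_chars_dvd_order:
  assumes G: "group G" "finite (carrier G)"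
  shows "card (linear_chars G) dvd Coset.order G"
proof -
  interpret G: group G by fact
  let ?D = "dual_group G" and ?DD = "dual_group (dual_group G)"
  define ev where "ev g = restrict (\<lambda>\<chi>. \<chi> g) (linear_chars G)" for g
  define E where "E = ev ` carrier G"
  have D: "group ?D" using comm_group_dual_group[OF G(1)] by (rule comm_group.axioms(2))
  have finD: "finite (carrier ?D)" using card_linear_chars_le[OF G] by (simp add: dual_group_simps)
  have DD: "group ?DD" using comm_group_dual_group[OF D] by (rule comm_group.axioms(2))
  have ev_mem: "ev g \<in> linear_chars ?D" if "g \<in> carrier G" for g
    using that linear_charsD(2)[where G = G] group.is_monoid[OF D]
      monoid.m_closed[OF group.is_monoid[OF D]] monoid.one_closed[OF group.is_monoid[OF D]]
    by (auto simp: linear_chars_def[of ?D] ev_def dual_group_simps)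
  have ev_mult: "ev (g \<otimes>\<^bsub>G\<^esub> h) = ev g \<otimes>\<^bsub>?DD\<^esub> ev h" if "g \<in> carrier G" "h \<in> carrier G" for g h
    using that linear_charsD(3)[where G = G] by (auto simp: ev_def dual_group_simps restrict_def fun_eq_iff)
  interpret ev: group_hom G ?DD ev
    by (intro group_hom.intro group_hom_axioms.intro G D DD homI)
      (use ev_mem ev_mult in \<open>auto simp: dual_group_simps\<close>)
  have "card (rcosets\<^bsub>G\<^esub> (Coset.kernel G ?DD ev)) = card E"
    unfolding E_def
  proof (rule G.card_rcosets_eq_card_image[OF ev.subgroup_kernel])
    fix x y assume xy: "x \<in> carrier G" "y \<in> carrier G"
    show "ev x = ev y \<longleftrightarrow> x \<otimes>\<^bsub>G\<^esub> inv\<^bsub>G\<^esub> y \<in> Coset.kernel G ?DD ev"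
      using xy by (simp add: Coset.kernel_def ev.hom_mult ev.hom_inv group.inv_solve_right'[OF DD])
  qed
  \<comment> \<open>Lagrange's theorem, applied to the kernel.\<close>
  then have dvd: "card E dvd Coset.order G"
    using G.lagrange[OF ev.subgroup_kernel] by (metis dvd_triv_left)
  have "card E \<le> card (linear_chars ?D)"
    using card_linear_chars_le(1)[OF D finD] ev_mem unfolding E_def by (intro card_mono) auto
  also have "\<dots> \<le> card (linear_chars G)"
    using card_linear_chars_le(2)[OF D finD] by (simp add: Coset.order_def dual_group_simps)
  finally have le: "card E \<le> card (linear_chars G)" .
  let ?E = "?DD\<lparr>carrier := E\<rparr>"
  have "subgroup E ?DD" unfolding E_def by (rule ev.img_is_subgroup)
  then have Egrp: "group ?E" by (rule subgroup.subgroup_is_group[OF _ DD])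
  have finE: "finite (carrier ?E)" unfolding E_def using G(2) by simp
  define r where "r \<chi> = restrict (\<lambda>e. e \<chi>) E" for \<chi> :: "'a \<Rightarrow> complex"
  have "inj_on r (linear_chars G)"
  proof (rule inj_onI)
    fix \<chi> \<psi> assume *: "\<chi> \<in> linear_chars G" "\<psi> \<in> linear_chars G" "r \<chi> = r \<psi>"
    show "\<chi> = \<psi>"
    proof (rule extensionalityI[OF linear_charsD(1)[OF *(1)] linear_charsD(1)[OF *(2)]])
      fix x assume "x \<in> carrier G"
      then have "ev x \<in> E" by (simp add: E_def)
      then have "ev x \<chi> = ev x \<psi>" using fun_cong[OF *(3), of "ev x"] by (simp add: r_def)
      then show "\<chi> x = \<psi> x" using * by (simp add: ev_def)
    qed
  qed
  moreover have "r ` linear_chars G \<subseteq> linear_chars ?E"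
  proof (rule image_subsetI)
    fix \<chi> assume \<chi>: "\<chi> \<in> linear_chars G"
    have one: "\<one>\<^bsub>?DD\<^esub> \<in> E" using group.is_monoid[OF Egrp] monoid.one_closed[of ?E] by simp
    have mult: "a \<otimes>\<^bsub>?DD\<^esub> b \<in> E" if "a \<in> E" "b \<in> E" for a b
      using monoid.m_closed[OF group.is_monoid[OF Egrp], of a b] that by simp
    show "r \<chi> \<in> linear_chars ?E"
      using \<chi> one mult by (auto simp: linear_chars_def[of ?E] r_def) (auto simp: dual_group_simps)
  qed
  ultimately have "card (linear_chars G) \<le> card (linear_chars ?E)"
    by (rule card_inj_on_le) (rule card_linear_chars_le(1)[OF Egrp finE])
  also have "\<dots> \<le> card E" using card_linear_chars_le(2)[OF Egrp finE] by (simp add: Coset.order_def)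
  finally show ?thesis using le dvd by simp
qed

section \<open>Codegree sums\<close>

lemma cod_le:
  assumes "group G" "finite (carrier G)" "\<chi> \<in> Irr G"
  shows "0 \<le> cod G \<chi>" "cod G \<chi> \<le> Coset.order G / Re (\<chi> \<one>\<^bsub>G\<^esub>)"
proof -
  obtain d where d: "d > 0" "\<chi> \<one>\<^bsub>G\<^esub> = of_nat d" using Irr_degree[OF assms(1,3)] by blast
  have "rcosets\<^bsub>G\<^esub> (char_ker G \<chi>) = (\<lambda>x. char_ker G \<chi> #>\<^bsub>G\<^esub> x) ` carrier G" by (auto simp: RCOSETS_def)
  then have "card (rcosets\<^bsub>G\<^esub> (char_ker G \<chi>)) \<le> Coset.order G"
    using assms(2) by (simp add: card_image_le Coset.order_def)
  then show "cod G \<chi> \<le> Coset.order G / Re (\<chi> \<one>\<^bsub>G\<^esub>)" "0 \<le> cod G \<chi>"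
    unfolding cod_def d by (auto intro!: divide_right_mono)
qed

text \<open>A linear character contributes at most its order in the dual group, a nonlinear one of
  degree \<open>d \<ge> 2\<close> at most \<open>n / d \<le> (n / 8) d\<^sup>2\<close>.\<close>

lemma S_c_le:
  assumes G: "group G" "finite (carrier G)" and n: "n = Coset.order G" and m: "m = card (linear_chars G)"
  shows "S_c G \<le> cyclic_order_sum m + n / 8 * (real n - m)"
proof -
  let ?L = "linear_chars G" and ?N = "Irr G - linear_chars G"
  note fin = Irr_sum_squares(1)[OF G] and sub = linear_chars_subset_Irr[OF G(1)]
  have split: "(\<Sum>\<chi>\<in>Irr G. f \<chi>) = (\<Sum>\<chi>\<in>?L. f \<chi>) + (\<Sum>\<chi>\<in>?N. f \<chi>)" for f :: "_ \<Rightarrow> real"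
    using sum.subset_diff[OF sub fin, of f] by simp
  have "(\<Sum>\<chi>\<in>?L. cod G \<chi>) \<le> (\<Sum>\<chi>\<in>?L. real (group.ord (dual_group G) \<chi>))"
    by (intro sum_mono cod_linear_char_le_ord G)
  also have "\<dots> = real (\<Sum>\<chi>\<in>carrier (dual_group G). group.ord (dual_group G) \<chi>)"
    by (simp add: dual_group_simps)
  also have "\<dots> \<le> real (cyclic_order_sum m)"
    using comm_group_sum_ord_le[OF comm_group_dual_group[OF G(1)]] card_linear_chars_le(1)[OF G]
    by (intro of_nat_mono) (simp add: dual_group_simps Coset.order_def m)
  finally have L: "(\<Sum>\<chi>\<in>?L. cod G \<chi>) \<le> cyclic_order_sum m" .
  have "(\<Sum>\<chi>\<in>?N. cod G \<chi>) \<le> (\<Sum>\<chi>\<in>?N. n / 8 * (Re (\<chi> \<one>\<^bsub>G\<^esub>))\<^sup>2)"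
  proof (rule sum_mono)
    fix \<chi> assume \<chi>: "\<chi> \<in> ?N"
    then obtain d where d: "d > 0" "\<chi> \<one>\<^bsub>G\<^esub> = of_nat d" "d \<noteq> 1" using Irr_degree[OF G(1), of \<chi>] by blast
    have "d \<ge> 2" using d by simp
    then have "2 ^ 3 \<le> real d ^ 3" by (intro power_mono) auto
    then have "real n * 8 \<le> real n * real d ^ 3" by (intro mult_left_mono) auto
    then have "real n / d \<le> n / 8 * (real d)\<^sup>2"
      using d(1) by (simp add: field_simps power3_eq_cube power2_eq_square)
    then have le: "real n / d \<le> n / 8 * (Re (\<chi> \<one>\<^bsub>G\<^esub>))\<^sup>2" by (simp add: d)
    have "cod G \<chi> \<le> real n / d" using cod_le(2)[OF G, of \<chi>] \<chi> d n by simp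
    then show "cod G \<chi> \<le> n / 8 * (Re (\<chi> \<one>\<^bsub>G\<^esub>))\<^sup>2" using le by (rule order_trans)
  qed
  also have "\<dots> = n / 8 * (\<Sum>\<chi>\<in>?N. (Re (\<chi> \<one>\<^bsub>G\<^esub>))\<^sup>2)" by (simp add: sum_distrib_left)
  also have "\<dots> \<le> n / 8 * (real n - m)"
  proof (rule mult_left_mono)
    have "(\<Sum>\<chi>\<in>?L. (Re (\<chi> \<one>\<^bsub>G\<^esub>))\<^sup>2) = m" by (simp add: linear_charsD(2) m)
    then show "(\<Sum>\<chi>\<in>?N. (Re (\<chi> \<one>\<^bsub>G\<^esub>))\<^sup>2) \<le> real n - m"
      using Irr_sum_squares(2)[OF G] split[of "\<lambda>\<chi>. (Re (\<chi> \<one>\<^bsub>G\<^esub>))\<^sup>2"] n by linarith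
  qed simp
  finally show ?thesis using L unfolding S_c_def split by linarith
qed

lemma cis_power_eq_iff_cong:
  fixes d i j :: nat
  assumes d: "d > 0"
  shows "cis (2 * pi / d) ^ i = cis (2 * pi / d) ^ j \<longleftrightarrow> [i = j] (mod d)"
proof -
  let ?w = "cis (2 * pi / d)"
  have "?w ^ d = 1" using d by (simp add: DeMoivre)
  then have red: "?w ^ k = ?w ^ (k mod d)" for k
    by (metis mult_div_mod_eq power_add power_mult power_one mult_1)
  have inj: "inj_on (\<lambda>k. cis (2 * pi * real k / real d)) {..<d}"
    using bij_betw_roots_unity[OF d] by (rule bij_betw_imp_inj_on)
  have "?w ^ k = cis (2 * pi * real k / real d)" for k by (simp add: DeMoivre mult_ac)
  then have "?w ^ i = ?w ^ j \<longleftrightarrow> i mod d = j mod d"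
    using inj_on_eq_iff[OF inj, of "i mod d" "j mod d"] d red[of i] red[of j] by simp
  then show ?thesis by (simp add: cong_def)
qed

text \<open>For \<open>d\<close> dividing \<open>n\<close> and \<open>a\<close> coprime to \<open>d\<close>, the character of the cyclic group of order
  \<open>n\<close> that sends the generator \<open>1\<close> to \<open>e\<^bsup>2\<pi>ia/d\<^esup>\<close>. Indexing by such pairs \<open>(d, a)\<close> matches the
  divisor sum, as the image of this character has \<open>d\<close> elements.\<close>

definition cyclic_char :: "nat \<Rightarrow> nat \<Rightarrow> nat \<Rightarrow> int \<Rightarrow> complex" where
  "cyclic_char n d a = restrict (\<lambda>x. cis (2 * pi / d) ^ (a * nat x)) (carrier (integer_mod_group n))"

lemma cyclic_char_linear:
  assumes "n > 0" "d dvd n"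
  shows "cyclic_char n d a \<in> linear_chars (integer_mod_group n)"
proof -
  have d: "d > 0" using assms by (auto intro!: Nat.gr0I)
  have "cis (2 * pi / d) ^ (a * nat ((x + y) mod int n)) = cis (2 * pi / d) ^ (a * nat x) * cis (2 * pi / d) ^ (a * nat y)"
    if "0 \<le> x" "0 \<le> y" for x y
  proof -
    have "nat ((x + y) mod int n) = (nat x + nat y) mod n" using that by (simp add: nat_mod_distrib nat_add_distrib)
    moreover have "[(nat x + nat y) mod n = nat x + nat y] (mod d)"
      using assms(2) by (simp add: cong_def mod_mod_cancel)
    ultimately have "[a * nat ((x + y) mod int n) = a * (nat x + nat y)] (mod d)"
      by (simp add: cong_scalar_left)
    then show ?thesis using cis_power_eq_iff_cong[OF d] by (simp add: power_add[symmetric] algebra_simps)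
  qed
  then show ?thesis using assms(1)
    by (auto simp: linear_chars_def cyclic_char_def carrier_integer_mod_group)
qed

lemma card_image_cyclic_char:
  assumes "n > 0" "d dvd n" "coprime a d"
  shows "card (cyclic_char n d a ` carrier (integer_mod_group n)) = d"
proof (rule antisym)
  have d: "d > 0" "d \<le> n" using assms by (auto intro!: Nat.gr0I dvd_imp_le)
  let ?w = "cis (2 * pi / d)" and ?C = "carrier (integer_mod_group n)"
  have fin: "finite ?C" using assms by (simp add: carrier_integer_mod_group)
  have "cyclic_char n d a ` ?C \<subseteq> {z. z ^ d = 1}"
    using cis_power_eq_iff_cong[OF d(1), of _ 0]
    by (auto simp: cyclic_char_def power_mult[symmetric] cong_def)
  then have "card (cyclic_char n d a ` ?C) \<le> card {z :: complex. z ^ d = 1}"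
    using d by (intro card_mono finite_roots_unity) auto
  then show "card (cyclic_char n d a ` ?C) \<le> d" using card_roots_unity_eq[OF d(1)] by simp
  have "inj_on (\<lambda>x. ?w ^ (a * x)) {..<d}"
    using assms(3) by (auto intro!: inj_onI simp: cis_power_eq_iff_cong[OF d(1)] cong_mult_lcancel_nat cong_less_modulus_unique_nat)
  then have "d = card ((\<lambda>x. ?w ^ (a * x)) ` {..<d})" by (simp add: card_image)
  also have "\<dots> \<le> card (cyclic_char n d a ` ?C)"
  proof (intro card_mono finite_imageI fin image_subsetI)
    fix x assume "x \<in> {..<d}"
    then show "?w ^ (a * x) \<in> cyclic_char n d a ` ?C"
      using d assms by (intro image_eqI[of _ _ "int x"]) (auto simp: cyclic_char_def carrier_integer_mod_group)
  qed
  finally show "d \<le> card (cyclic_char n d a ` ?C)" .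
qed

text \<open>The size of the image recovers \<open>d\<close>, and the value at the generator \<open>1\<close> recovers \<open>a\<close>
  modulo \<open>d\<close>. The trivial character is treated separately, since the element \<open>1\<close> is missing from
  the carrier when \<open>n = 1\<close>.\<close>

lemma cyclic_char_inj:
  assumes n: "n > 0"
  shows "inj_on (\<lambda>(d, a). cyclic_char n d a) (SIGMA d:{d. d dvd n}. totatives d)"
proof (rule inj_onI, clarsimp)
  fix d a e b assume *: "d dvd n" "a \<in> totatives d" "e dvd n" "b \<in> totatives e"
    "cyclic_char n d a = cyclic_char n e b"
  have "coprime a d" "coprime b e" using * by (auto simp: totatives_def)
  then have de: "d = e" using card_image_cyclic_char[OF n *(1)] card_image_cyclic_char[OF n *(3)] *(5) by metis
  have "a = b"
  proof (cases "d = 1")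
    case True then show ?thesis using * de by simp
  next
    case False
    have d: "d > 0" "d \<le> n" using * n by (auto intro!: Nat.gr0I dvd_imp_le)
    have "a < d" "b < d" using totatives_less[of a d] totatives_less[of b d] * False d de by auto
    moreover have "(1::int) \<in> carrier (integer_mod_group n)" using False d by (auto simp: carrier_integer_mod_group)
    then have "cis (2 * pi / d) ^ a = cis (2 * pi / d) ^ b"
      using fun_cong[OF *(5), of 1] de by (simp add: cyclic_char_def)
    then have "[a = b] (mod d)" using cis_power_eq_iff_cong[OF d(1)] by simp
    ultimately show ?thesis by (rule cong_less_modulus_unique_nat[rotated 1])
  qed
  then show "d = e \<and> a = b" using de by simp
qed

lemma S_c_cyclic_ge:
  assumes n: "n > 0"
  shows "cyclic_order_sum n \<le> S_c (integer_mod_group n)"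
proof -
  let ?C = "integer_mod_group n" and ?I = "SIGMA d:{d. d dvd n}. totatives d"
  have C: "group ?C" "finite (carrier ?C)" using n by (simp_all add: carrier_integer_mod_group)
  have "real (cyclic_order_sum n) = (\<Sum>d | d dvd n. \<Sum>a\<in>totatives d. real d)"
    by (simp add: cyclic_order_sum_def totient_def mult.commute)
  also have "\<dots> = (\<Sum>(d, a)\<in>?I. real d)"
    using n by (intro sum.Sigma) auto
  also have "\<dots> = (\<Sum>(d, a)\<in>?I. cod ?C (cyclic_char n d a))"
    using cod_linear_char[OF C(1) cyclic_char_linear[OF n]] card_image_cyclic_char[OF n]
    by (intro sum.cong) (auto simp: totatives_def)
  also have "\<dots> = (\<Sum>\<chi>\<in>(\<lambda>(d, a). cyclic_char n d a) ` ?I. cod ?C \<chi>)"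
    by (subst sum.reindex[OF cyclic_char_inj[OF n]]) (simp add: case_prod_beta)
  also have "\<dots> \<le> (\<Sum>\<chi>\<in>Irr ?C. cod ?C \<chi>)"
  proof (rule sum_mono2[OF Irr_sum_squares(1)[OF C]])
    show "(\<lambda>(d, a). cyclic_char n d a) ` ?I \<subseteq> Irr ?C"
      using cyclic_char_linear[OF n] linear_chars_subset_Irr[OF C(1)] by auto
  qed (use cod_le(1)[OF C] in auto)
  finally show ?thesis by (simp add: S_c_def)
qed

theorem theorem1p4:
  fixes G :: "('a, 'b) monoid_scheme" and n :: nat
  assumes "group G" and "finite (carrier G)" and "Coset.order G = n"
    and "card (prime_factors n) \<le> 99"
  shows "S_c G \<le> S_c (integer_mod_group n)"
proof -
  interpret group G by fact
  have n: "n > 0" using order_gt_0_iff_finite assms by blast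
  define m where "m = card (linear_chars G)"
  have dvd: "m dvd n" using card_linear_chars_dvd_order[OF assms(1,2)] assms(3) by (simp add: m_def)
  then have mn: "real m \<le> real n" using n by (simp add: dvd_imp_le)
  have "real (n ^ 2) \<le> real (8 * cyclic_order_sum n)"
    using square_le_8_cyclic_order_sum[OF n assms(4)] of_nat_le_iff by blast
  then have sq: "real n / 8 * real n \<le> cyclic_order_sum n" by (simp add: power2_eq_square)
  have "S_c G * n \<le> (cyclic_order_sum m + real n / 8 * (real n - m)) * n"
    using S_c_le[OF assms(1,2) assms(3)[symmetric] m_def] by (intro mult_right_mono) auto
  also have "\<dots> = cyclic_order_sum m * real n + (real n / 8 * real n) * (real n - m)"
    by (simp add: algebra_simps)
  also have "\<dots> \<le> cyclic_order_sum n * real m + cyclic_order_sum n * (real n - m)"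
    using cyclic_order_sum_mono_ratio[OF dvd n] sq mn by (intro add_mono mult_right_mono) auto
  also have "\<dots> = cyclic_order_sum n * real n" by (simp add: algebra_simps)
  finally have "S_c G \<le> cyclic_order_sum n" using n by simp
  also have "\<dots> \<le> S_c (integer_mod_group n)" by (rule S_c_cyclic_ge[OF n])
  finally show ?thesis .
qed

end
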